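(* Suppose that $D_K(\mathbb{P},\mathbb{Q})<\infty$ and that there is some $g\in\mathcal{G}$ with $g=g_0$ almost surely. (a) Assume the envelope conditions $$\int G_0\,d\mathbb{Q}<\infty\qquad\text{and}\qquad \int G_1\,d\mathbb{P}<\infty,$$ and suppose that for all $\delta>0$, $$\frac1n\,\mathcal{H}_\delta(\mathcal{G}-g_0,L_1(\mathbb{Q}_n))\to 0\ \text{ in } \mathbb{Q}\text{-probability},\qquad \frac1n\,\mathcal{H}_\delta(\log(\mathcal{G}/g_0),L_1(\mathbb{P}_n))\to 0\ \text{ in } \mathbb{P}\text{-probability}.$$ Then $|\widehat D_K-D_K(\mathbb{P},\mathbb{Q})|\to 0$ almost surely and $h_{\mathbb{Q}}(g_0,\widehat g_n)\to 0$ almost surely. (b) Suppose only that $\int G_0\,d\mathbb{Q}<\infty$ and that for all $\delta>0$, $$\frac1n\,\mathcal{H}_\delta(\mathcal{G}-g_0,L_1(\mathbb{Q}_n))\to 0\ \text{ in } \mathbb{Q}\text{-probability},\qquad \frac1n\,\mathcal{H}_\delta\Big(\log\frac{\mathcal{G}+g_0}{2g_0},L_1(\mathbb{P}_n)\Big)\to 0\ \text{ in } \mathbb{P}\text{-probability}.$$ Then $h_{\mathbb{Q}}(g_0,\widehat g_n)\to 0$ almost surely.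
   Context: Setting: $\mathbb{P},\mathbb{Q}$ are probability distributions on a compact domain $\mathcal{X}\subset\mathbb{R}^d$, absolutely continuous with respect to Lebesgue measure $\mu$ with densities $p_0,q_0$; $\mathbb{P}$ is absolutely continuous with respect to $\mathbb{Q}$, and the two share the same support (so "almost surely" for functions on $\mathcal X$ may be taken with respect to either). Put $g_0:=p_0/q_0$ (the likelihood ratio) and $D_K(\mathbb{P},\mathbb{Q}):=\int p_0\log(p_0/q_0)\,d\mu$. Samples: $X^{(1)},\dots,X^{(n)}$ are i.i.d. from $\mathbb{P}$ and $Y^{(1)},\dots,Y^{(n)}$ are i.i.d. from $\mathbb{Q}$ (the two samples independent); $\mathbb{P}_n=\frac1n\sum_i\delta_{X^{(i)}}$ and $\mathbb{Q}_n=\frac1n\sum_i\delta_{Y^{(i)}}$ are the empirical distributions. Estimator E1: $\mathcal{G}$ is a fixed class of functions $g:\mathcal{X}\to\mathbb{R}_+$ and $$\widehat g_n\in\arg\max_{g\in\mathcal{G}}\Big\{\int\log g\,d\mathbb{P}_n-\int g\,d\mathbb{Q}_n\Big\},\qquad \widehat D_K=\int\log\widehat g_n\,d\mathbb{P}_n-\int\widehat g_n\,d\mathbb{Q}_n+1$$ (the maximum is assumed attained). Hellinger distance: $h_{\mathbb{Q}}^2(g_0,g):=\frac12\int(\sqrt{g_0}-\sqrt g)^2\,d\mathbb{Q}$. Envelopes: $G_0(x)=\sup_{g\in\mathcal{G}}|g(x)|$, $G_1(x)=\sup_{g\in\mathcal{G}}\big|\log\frac{g(x)}{g_0(x)}\big|$.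 Function classes: $\mathcal{G}-g_0=\{g-g_0:g\in\mathcal{G}\}$, $\log(\mathcal{G}/g_0)=\{\log(g/g_0):g\in\mathcal{G}\}$, $\log\frac{\mathcal{G}+g_0}{2g_0}=\{\log\frac{g+g_0}{2g_0}:g\in\mathcal{G}\}$. Metric entropy: for a probability measure $R$, $\|f\|_{L_1(R)}=\int|f|\,dR$; $N_\delta(\mathcal{F},L_1(R))$ is the smallest number of $L_1(R)$-balls of radius $\delta$ covering $\mathcal{F}$, and $\mathcal{H}_\delta(\mathcal{F},L_1(R)):=\log N_\delta(\mathcal{F},L_1(R))$.
   Formalization: In each part, the two function classes whose entropies appear are also assumed measurable: suprema of |Σ e_i f(x_i)| over the class are measurable for the completed product measure. Without this, non-measurable classes give counterexamples (under CH). *)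

theory Defs
  imports "HOL-Probability.Probability"
begin

text \<open>
  Logarithm with \<open>log 0 = - \<infinity>\<close>. The library function \<open>ln\<close> has \<open>ln 0 = 0\<close>, which would let a
  function vanishing at a sample point compete in the maximisation below.
\<close>

definition ext_ln :: "real \<Rightarrow> ereal" where
  "ext_ln x = (if 0 < x then ereal (ln x) else - \<infinity>)"

text \<open>
  Integral of an extended-real function as positive part minus negative part, so that the
  values \<open>\<plusminus>\<infinity>\<close> are not collapsed to \<open>0\<close> as they are by the Bochner integral.
\<close>

definition ext_integral :: "'a measure \<Rightarrow> ('a \<Rightarrow> ereal) \<Rightarrow> ereal" where
  "ext_integral R f =
     enn2ereal (\<integral>\<^sup>+x. e2ennreal (f x) \<partial>R) - enn2ereal (\<integral>\<^sup>+x. e2ennreal (- f x) \<partial>R)"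

definition KL_div :: "'a measure \<Rightarrow> ('a \<Rightarrow> real) \<Rightarrow> ('a \<Rightarrow> real) \<Rightarrow> ereal" where
  "KL_div \<mu> p q = ext_integral \<mu> (\<lambda>x. ereal (p x * ln (p x / q x)))"

text \<open>
  The distribution \<open>(1/n) \<Sum>\<^bsub>i<n\<^esub> \<delta>\<^bsub>x i\<^esub>\<close> for \<open>n > 0\<close>, on the full power set, so that
  every function is measurable for it (for \<open>n = 0\<close> it is unspecified and never matters).
\<close>

definition empirical :: "nat \<Rightarrow> (nat \<Rightarrow> 'a) \<Rightarrow> 'a measure" where
  "empirical n x = measure_pmf (map_pmf x (pmf_of_set {..<n}))"

definition ratio_objective :: "'a measure \<Rightarrow> 'a measure \<Rightarrow> ('a \<Rightarrow> real) \<Rightarrow> ereal" where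
  "ratio_objective Pn Qn g = ext_integral Pn (\<lambda>x. ext_ln (g x)) - ereal (\<integral>x. g x \<partial>Qn)"

text \<open>The integrand is bounded by \<open>g0 + g\<close>, so the Bochner integral is the true one whenever
  \<open>g0\<close> and \<open>g\<close> are \<open>Q\<close>-integrable.\<close>

definition hellinger :: "'a measure \<Rightarrow> ('a \<Rightarrow> real) \<Rightarrow> ('a \<Rightarrow> real) \<Rightarrow> real" where
  "hellinger Q g0 g = sqrt ((1 / 2) * (\<integral>x. (sqrt (g0 x) - sqrt (g x))\<^sup>2 \<partial>Q))"

definition envelope0 :: "('a \<Rightarrow> real) set \<Rightarrow> 'a \<Rightarrow> ennreal" where
  "envelope0 G x = (SUP g\<in>G. ennreal \<bar>g x\<bar>)"

definition envelope1 :: "('a \<Rightarrow> real) set \<Rightarrow> ('a \<Rightarrow> real) \<Rightarrow> 'a \<Rightarrow> ennreal" where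
  "envelope1 G g0 x = (SUP g\<in>G. e2ennreal \<bar>ext_ln (g x / g0 x)\<bar>)"

definition diff_class :: "('a \<Rightarrow> real) set \<Rightarrow> ('a \<Rightarrow> real) \<Rightarrow> ('a \<Rightarrow> real) set" where
  "diff_class G g0 = (\<lambda>g x. g x - g0 x) ` G"

text \<open>
  Real-valued, hence with \<open>ln\<close>. If \<open>\<integral> envelope1 G g0 dP < \<infinity>\<close>, then each \<open>g \<in> G\<close> is positive
  \<open>P\<close>-almost everywhere, and \<open>g0 > 0\<close> holds \<open>P\<close>-almost everywhere, so the value \<open>ln 0 = 0\<close>
  is used only on \<open>P\<close>-null sets.
\<close>

definition log_ratio_class :: "('a \<Rightarrow> real) set \<Rightarrow> ('a \<Rightarrow> real) \<Rightarrow> ('a \<Rightarrow> real) set" where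
  "log_ratio_class G g0 = (\<lambda>g x. ln (g x / g0 x)) ` G"

definition log_mid_class :: "('a \<Rightarrow> real) set \<Rightarrow> ('a \<Rightarrow> real) \<Rightarrow> ('a \<Rightarrow> real) set" where
  "log_mid_class G g0 = (\<lambda>g x. ln ((g x + g0 x) / (2 * g0 x))) ` G"

text \<open>
  Closed balls with centres anywhere in \<open>L\<^sub>1(R)\<close>. Open balls, or centres in \<open>F\<close>, change \<open>\<delta>\<close>
  by at most a constant factor. The value is \<open>\<infinity>\<close> if no finite cover exists.
\<close>

definition covering_number :: "real \<Rightarrow> ('a \<Rightarrow> real) set \<Rightarrow> 'a measure \<Rightarrow> enat" where
  "covering_number \<delta> F R =
     (INF C\<in>{C. finite C \<and> (\<forall>c\<in>C. integrable R c) \<and>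
                (\<forall>f\<in>F. \<exists>c\<in>C. (\<integral>\<^sup>+x. ennreal \<bar>f x - c x\<bar> \<partial>R) \<le> ennreal \<delta>)}. enat (card C))"

definition metric_entropy :: "real \<Rightarrow> ('a \<Rightarrow> real) set \<Rightarrow> 'a measure \<Rightarrow> ereal" where
  "metric_entropy \<delta> F R =
     (case covering_number \<delta> F R of enat N \<Rightarrow> ext_ln (real N) | \<infinity> \<Rightarrow> \<infinity>)"

text \<open>
  Convergence to zero in probability. Random entropies need not be measurable, so this is stated
  with outer probability; for measurable \<open>Z n\<close> it is the usual notion.
\<close>

definition tendsto_zero_in_prob :: "'w measure \<Rightarrow> (nat \<Rightarrow> 'w \<Rightarrow> ereal) \<Rightarrow> bool" where
  "tendsto_zero_in_prob M Z \<longleftrightarrow>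
     (\<forall>\<epsilon>>0. (\<lambda>n. outer_measure_of M {\<omega>\<in>space M. \<bar>Z n \<omega>\<bar> > ereal \<epsilon>}) \<longlonglongrightarrow> 0)"

text \<open>
  Measurability of a class of functions in the sense of van der Vaart and Wellner
  (\<open>R\<close>-measurable class): suprema of \<open>\<bar>\<Sum>\<^bsub>i<n\<^esub> e i * f (x i)\<bar>\<close> over the class are
  measurable for the completed product measure. It holds in particular for countable
  and for pointwise separable classes of measurable functions.
\<close>

definition sup_measurable_class :: "'a measure \<Rightarrow> ('a \<Rightarrow> real) set \<Rightarrow> bool" where
  "sup_measurable_class R F \<longleftrightarrow>
     (\<forall>n. \<forall>e::nat \<Rightarrow> real.
        (\<lambda>x. SUP f\<in>F. ennreal \<bar>\<Sum>i<n. e i * f (x i)\<bar>)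
          \<in> borel_measurable (completion (PiM {..<n} (\<lambda>_. R))))"

end

theory Submission
  imports Defs
begin

text \<open>
  Both empirical integrals obey a uniform law of large numbers. Exchanging the sample with a ghost
  sample bounds the mean deviation by signed sums; given the sample, a finite \<open>L\<^sub>1\<close> cover and a
  truncation reduce the supremum to a finite maximum of sub-Gaussian variables, which is small
  when the entropy is \<open>o(n)\<close>. Convergence of the means becomes almost sure because \<open>n\<close> times the
  deviation is subadditive: for fixed \<open>m\<close> it is at most a sum over disjoint blocks of length \<open>m\<close>,
  and the averages over blocks converge by the ergodic theorem for the Bernoulli shift (Garsia's
  maximal inequality and the zero-one law), of which the strong law is the case \<open>m = 1\<close>.

  As the estimator does at least as well as \<open>g0\<close> on the sample, the uniform laws give
  \<open>\<integral> ln (g / g0) dP - \<integral> (g - g0) dQ \<ge> - \<epsilon>\<close> for \<open>g\<close> the estimator, whereas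
  \<open>ln x \<le> 2 (sqrt x - 1)\<close> bounds the left side by \<open>- 2 h\<^sup>2\<close>. In part (b), concavity of \<open>ln\<close>
  replaces \<open>g\<close> by the midpoint of \<open>g\<close> and \<open>g0\<close>, for which \<open>ln\<close> is bounded from below.
\<close>

text \<open>The entropy hypothesis is weak in two ways: it gives convergence in probability only,
  and for quantities that need not be measurable. No summable bound over \<open>n\<close> is
  available, so entropy is asked for a single block length \<open>m\<close> with small mean
  deviation, and subadditivity does the rest. As to measurability, every supremum is replaced by a
  Borel version equal to it almost everywhere, and almost sure statements quantify over the class
  inside the almost-everywhere quantifier. The event of large entropy enters only through its
  measurable subsets: a measurable set of paths pulls back to an event of the same probability,
  whereas the outer measure of a set of paths may exceed that of its preimage. In part (b) the
  difficulty is that the midpoint need not belong to the class, so optimality of the estimator has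
  to be handed on to it before the two uniform laws can be used.\<close>

section \<open>Ergodic averages over the Bernoulli shift\<close>

text \<open>The maximum of 0 and the Birkhoff sums of length 1 to \<open>n\<close>. The recursion
  splits off the first summand, so that \<open>max_sum T f (Suc n)\<close> at \<open>x\<close> meets
  \<open>max_sum T f n\<close> at \<open>T x\<close>, the comparison on which Garsia's argument
  rests.\<close>

primrec max_sum :: "('a \<Rightarrow> 'a) \<Rightarrow> ('a \<Rightarrow> real) \<Rightarrow> nat \<Rightarrow> 'a \<Rightarrow> real" where
  "max_sum T f 0 x = 0"
| "max_sum T f (Suc n) x = max 0 (f x + max_sum T f n (T x))"

lemma max_sum_nonneg: "0 \<le> max_sum T f n x"
  by (cases n) auto

lemma max_sum_mono: "max_sum T f n x \<le> max_sum T f (Suc n) x"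
proof (induction n arbitrary: x)
  case (Suc n)
  show ?case using Suc[of "T x"] by (simp del: max_sum.simps add: max_sum.simps(2)[of T f n] max_sum.simps(2)[of T f "Suc n"])
qed simp

lemma sum_le_max_sum: "(\<Sum>j<n. f ((T ^^ j) x)) \<le> max_sum T f n x"
proof (induction n arbitrary: x)
  case (Suc n)
  have "(\<Sum>j<Suc n. f ((T ^^ j) x)) = f x + (\<Sum>j<n. f ((T ^^ j) (T x)))"
    by (simp add: sum.lessThan_Suc_shift funpow_Suc_right del: funpow.simps sum.lessThan_Suc)
  with Suc[of "T x"] show ?case by simp
qed simp

text \<open>The increment \<open>D n\<close> has nonnegative integral because \<open>T\<close>
  preserves the measure and \<open>max_sum\<close> grows with \<open>n\<close>. Once the maximum at
  \<open>x\<close> is positive the increment is \<open>f x\<close> itself, and \<open>pos\<close>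
  makes this happen almost everywhere for large \<open>n\<close>, so dominated convergence passes
  the sign on to the integral of \<open>f\<close>.\<close>

lemma maximal_ergodic:
  fixes f :: "'a \<Rightarrow> real"
  assumes T[measurable]: "T \<in> measurable M M" and pres: "distr M M T = M"
    and f: "integrable M f"
    and pos: "AE x in M. \<exists>n. 0 < (\<Sum>j<n. f ((T ^^ j) x))"
  shows "0 \<le> (\<integral>x. f x \<partial>M)"
proof -
  have [measurable]: "f \<in> borel_measurable M" using f by simp
  have meas[measurable]: "max_sum T f n \<in> borel_measurable M" for n
  proof (induction n)
    case (Suc n)
    note [measurable] = Suc
    show ?case by (subst max_sum.simps(2)[abs_def]) measurable
  qed (simp add: max_sum.simps(1)[abs_def])
  have comp: "integrable M (\<lambda>x. g (T x)) \<and> (\<integral>x. g (T x) \<partial>M) = (\<integral>x. g x \<partial>M)"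
    if g: "integrable M g" for g :: "'a \<Rightarrow> real"
  proof
    have [measurable]: "g \<in> borel_measurable M" using g by simp
    show "integrable M (\<lambda>x. g (T x))"
      using g integrable_distr_eq[of T M M g] by (simp add: pres)
    show "(\<integral>x. g (T x) \<partial>M) = (\<integral>x. g x \<partial>M)"
      using integral_distr[of T M M g] by (simp add: pres)
  qed
  have int: "integrable M (max_sum T f n)" for n
  proof (induction n)
    case (Suc n)
    have "integrable M (\<lambda>x. max 0 (f x + max_sum T f n (T x)))"
      using f comp[OF Suc] by auto
    then show ?case by (subst max_sum.simps(2)[abs_def])
  qed (simp add: max_sum.simps(1)[abs_def])
  define D where "D n x = max_sum T f (Suc n) x - max_sum T f n (T x)" for n x
  have D: "0 \<le> (\<integral>x. D n x \<partial>M)" for n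
  proof -
    have "(\<integral>x. D n x \<partial>M) = (\<integral>x. max_sum T f (Suc n) x \<partial>M) - (\<integral>x. max_sum T f n x \<partial>M)"
      unfolding D_def using int[of "Suc n"] comp[OF int[of n]]
      by (subst Bochner_Integration.integral_diff) (auto simp del: max_sum.simps)
    moreover have "(\<integral>x. max_sum T f n x \<partial>M) \<le> (\<integral>x. max_sum T f (Suc n) x \<partial>M)"
      by (intro integral_mono int max_sum_mono)
    ultimately show ?thesis by simp
  qed
  have lim: "(\<lambda>n. \<integral>x. D n x \<partial>M) \<longlonglongrightarrow> (\<integral>x. f x \<partial>M)"
  proof (rule integral_dominated_convergence[where w="\<lambda>x. \<bar>f x\<bar>"])
    show "D n \<in> borel_measurable M" for n unfolding D_def[abs_def] by measurable
    show "AE x in M. norm (D n x) \<le> \<bar>f x\<bar>" for n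
    proof (rule AE_I2)
      fix x
      \<comment> \<open>With \<open>m = max_sum T f n (T x)\<close>, \<open>D n x\<close> is
        \<open>max 0 (f x + m) - m\<close>, that is \<open>max (- m) (f x)\<close>, and
        \<open>m\<close> is nonnegative.\<close>
      show "norm (D n x) \<le> \<bar>f x\<bar>"
        using max_sum_nonneg[of T f n "T x"] by (auto simp: D_def)
    qed
    show "AE x in M. (\<lambda>n. D n x) \<longlonglongrightarrow> f x"
      using pos
    proof eventually_elim
      case (elim x)
      then obtain n where n: "0 < (\<Sum>j<n. f ((T ^^ j) x))" by auto
      have "D k x = f x" if "k \<ge> n" for k
      proof -
        have "max_sum T f n x \<le> max_sum T f (Suc k) x"
          by (rule lift_Suc_mono_le[of "\<lambda>n. max_sum T f n x"]) (use that max_sum_mono in \<open>auto simp del: max_sum.simps\<close>)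
        with n sum_le_max_sum[of f T x n] have "0 < max_sum T f (Suc k) x"
          by simp
        then show ?thesis by (auto simp: D_def max_def split: if_splits)
      qed
      then show ?case
        by (intro tendsto_eventually) (auto simp: eventually_sequentially)
    qed
  qed (use f in auto)
  show ?thesis by (rule LIMSEQ_le_const[OF lim]) (use D in auto)
qed

section \<open>Invariant events and Birkhoff averages for shifts by \<open>m\<close> places\<close>

definition seq_shift :: "nat \<Rightarrow> (nat \<Rightarrow> 'a) \<Rightarrow> nat \<Rightarrow> 'a" where
  "seq_shift m x = (\<lambda>i. x (i + m))"

lemma funpow_shift: "(seq_shift m ^^ j) x = seq_shift (j * m) x"
  by (induction j) (auto simp: seq_shift_def add.assoc add.commute)

context sequence_space
begin

lemma measurable_reindex: "(\<lambda>x i. x (f i)) \<in> measurable S S"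
  by (rule measurable_PiM_single') (auto simp: space_PiM)

lemma measurable_shift [measurable]: "seq_shift m \<in> measurable S S"
  unfolding seq_shift_def[abs_def] by (rule measurable_reindex)

lemma distr_reindex: "inj f \<Longrightarrow> distr S S (\<lambda>x i. x (f i)) = S"
  using distr_PiM_reindex[of UNIV "\<lambda>_. M" f UNIV] by (simp add: M.prob_space_axioms restrict_def)

lemma distr_shift: "distr S S (seq_shift m) = S"
  unfolding seq_shift_def[abs_def] by (rule distr_reindex) (auto simp: inj_def)

lemma shift_space: "x \<in> space S \<Longrightarrow> seq_shift m x \<in> space S"
  by (auto simp: space_PiM seq_shift_def)

lemma indep_coords: "P.indep_vars (\<lambda>_. M) (\<lambda>i x. x i) UNIV"
  by (subst P.indep_vars_iff_distr_eq_PiM) (auto simp: PiM_component restrict_def distr_id2)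

text \<open>Using the invariance \<open>n\<close> times rewrites \<open>B\<close> as a condition on
  \<open>seq_shift (n * m) x\<close>, hence on the coordinates from \<open>n\<close> on. As
  \<open>n\<close> is arbitrary, \<open>B\<close> is a tail event of the independent
  coordinates.\<close>

lemma invariant_zero_one:
  assumes B: "B \<in> sets S" and m: "0 < m"
    and inv: "\<And>x. x \<in> space S \<Longrightarrow> x \<in> B \<longleftrightarrow> seq_shift m x \<in> B"
  shows "P.prob B = 0 \<or> P.prob B = 1"
proof -
  define A where "A i = sigma_sets (space S) {(\<lambda>x. x i) -` A \<inter> space S | A. A \<in> sets M}" for i :: nat
  have Asub: "A i \<subseteq> Pow (space S)" for i
    unfolding A_def by (auto dest: sigma_sets_into_sp[rotated])
  show ?thesis
  proof (rule P.kolmogorov_0_1_law)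
    show "sigma_algebra (space S) (A i)" for i
      unfolding A_def by (rule sigma_algebra_sigma_sets) auto
    show "P.indep_sets A UNIV"
      using indep_coords unfolding P.indep_vars_def A_def by auto
    have inv': "x \<in> B \<longleftrightarrow> seq_shift (k * m) x \<in> B" if "x \<in> space S" for x k
    proof (induction k)
      case (Suc k)
      have "seq_shift (k * m) x \<in> space S"
        using that by (rule shift_space)
      from inv[OF this] Suc show ?case
        by (simp add: seq_shift_def add_ac)
    qed (simp add: seq_shift_def)
    show "B \<in> P.tail_events A"
      unfolding P.tail_events_def
    proof
      fix n
      let ?N = "sigma (space S) (\<Union>(A ` {n..}))"
      have sp: "space ?N = space S" and st: "sets ?N = sigma_sets (space S) (\<Union>(A ` {n..}))"
        using Asub by (auto intro!: space_measure_of sets_measure_of)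
      have "seq_shift (n * m) \<in> measurable ?N S"
        unfolding seq_shift_def[abs_def]
      proof (rule measurable_PiM_single')
        fix i :: nat
        have "i + n * m \<ge> n" using m by (cases m) auto
        show "(\<lambda>x. x (i + n * m)) \<in> measurable ?N M"
        proof (rule measurableI)
          fix C assume "C \<in> sets M"
          then have "(\<lambda>x. x (i + n * m)) -` C \<inter> space S \<in> A (i + n * m)"
            unfolding A_def by blast
          then show "(\<lambda>x. x (i + n * m)) -` C \<inter> space ?N \<in> sets ?N"
            unfolding sp st using \<open>i + n * m \<ge> n\<close> by (intro sigma_sets.Basic) auto
        qed (simp only: sp, auto simp: space_PiM)
      qed (simp only: sp, auto simp: space_PiM)
      from measurable_sets[OF this B] have "seq_shift (n * m) -` B \<inter> space S \<in> sigma_sets (space S) (\<Union>(A ` {n..}))"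
        by (simp only: sp st)
      also have "seq_shift (n * m) -` B \<inter> space S = B"
        using inv'[of _ n] sets.sets_into_space[OF B] by auto
      finally show "B \<in> sigma_sets (space S) (\<Union>(A ` {n..}))" .
    qed
  qed
qed

text \<open>Boundedness above of the partial sums is unaffected by dropping the first summand, so it
  has probability 0 or 1. With probability 0, some partial sum would be positive almost everywhere,
  and the maximal inequality would contradict \<open>neg\<close>.\<close>

lemma bounded_sums_shift:
  fixes f :: "(nat \<Rightarrow> 'a) \<Rightarrow> real"
  assumes f: "integrable S f" and neg: "(\<integral>x. f x \<partial>S) < 0" and m: "0 < m"
  shows "AE x in S. \<exists>K. \<forall>n. (\<Sum>j<n. f (seq_shift (j * m) x)) \<le> K"
proof -
  have [measurable]: "f \<in> borel_measurable S" using f by simp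
  \<comment> \<open>Natural bounds keep the event a countable union of measurable sets;
    \<open>real_nat\<close> returns to real bounds.\<close>
  define B where "B = {x\<in>space S. \<exists>K::nat. \<forall>n. (\<Sum>j<n. f (seq_shift (j * m) x)) \<le> real K}"
  have [measurable]: "(\<lambda>x. f (seq_shift (j * m) x)) \<in> borel_measurable S" for j
    by (rule measurable_compose[OF measurable_shift]) simp
  have B: "B \<in> sets S" unfolding B_def by measurable
  have real_nat: "(\<exists>K::nat. \<forall>n. g n \<le> real K) \<longleftrightarrow> (\<exists>K::real. \<forall>n. g n \<le> K)" for g :: "nat \<Rightarrow> real"
    by (meson order_trans real_arch_simple)
  have "P.prob B = 0 \<or> P.prob B = 1"
  proof (rule invariant_zero_one[OF B m])
    fix x assume x: "x \<in> space S"
    then have sx: "seq_shift m x \<in> space S" by (rule shift_space)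
    have step: "(\<Sum>j<Suc n. f (seq_shift (j * m) x)) = f x + (\<Sum>j<n. f (seq_shift (j * m) (seq_shift m x)))" for n
      by (simp add: sum.lessThan_Suc_shift seq_shift_def add_ac del: sum.lessThan_Suc)
    have "(\<exists>K. \<forall>n. (\<Sum>j<n. f (seq_shift (j * m) x)) \<le> K)
        \<longleftrightarrow> (\<exists>K. \<forall>n. (\<Sum>j<n. f (seq_shift (j * m) (seq_shift m x))) \<le> K)" (is "?L \<longleftrightarrow> ?R")
    proof
      assume ?L
      then obtain K where K: "\<And>n. (\<Sum>j<n. f (seq_shift (j * m) x)) \<le> K" by auto
      have "\<forall>n. (\<Sum>j<n. f (seq_shift (j * m) (seq_shift m x))) \<le> K - f x"
        using K[of "Suc n" for n] unfolding step by (auto simp: algebra_simps)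
      then show ?R by blast
    next
      assume ?R
      then obtain K where K: "\<And>n. (\<Sum>j<n. f (seq_shift (j * m) (seq_shift m x))) \<le> K" by auto
      \<comment> \<open>The maximum with 0 covers \<open>n = 0\<close>, where there is no first
        summand to split off.\<close>
      have "(\<Sum>j<n. f (seq_shift (j * m) x)) \<le> max 0 (K + f x)" for n
        using K[of "n - 1"] step[of "n - 1"] by (cases n) (auto simp del: sum.lessThan_Suc)
      then show ?L by blast
    qed
    then show "x \<in> B \<longleftrightarrow> seq_shift m x \<in> B"
      using x sx unfolding B_def real_nat by auto
  qed
  moreover have "P.prob B \<noteq> 0"
  proof
    assume "P.prob B = 0"
    then have "AE x in S. x \<notin> B"
      using B by (intro AE_not_in) (auto simp: null_sets_def P.emeasure_eq_measure)
    moreover have "AE x in S. x \<in> space S" by simp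
    ultimately have "AE x in S. \<exists>n. 0 < (\<Sum>j<n. f ((seq_shift m ^^ j) x))"
    proof eventually_elim
      case (elim x)
      then show ?case unfolding B_def funpow_shift
        by (auto simp: not_le dest!: spec[of _ 0])
    qed
    from maximal_ergodic[OF measurable_shift distr_shift f this] neg show False by simp
  qed
  ultimately have "AE x in S. x \<in> B" using P.prob_eq_1[OF B] by auto
  then show ?thesis unfolding B_def by eventually_elim auto
qed

text \<open>Subtracting slightly more than the mean makes the mean negative, so the centred sums are
  bounded above and their bound vanishes after division by \<open>n\<close>. This is the upper
  estimate; \<open>- f\<close> gives the lower one.\<close>

lemma ergodic_average:
  fixes f :: "(nat \<Rightarrow> 'a) \<Rightarrow> real"
  assumes f: "integrable S f" and m: "0 < m"
  shows "AE x in S. (\<lambda>n. (\<Sum>j<n. f (seq_shift (j * m) x)) / real n) \<longlonglongrightarrow> (\<integral>x. f x \<partial>S)"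
proof -
  let ?I = "\<integral>x. f x \<partial>S"
  have upper: "AE x in S. \<forall>q. eventually (\<lambda>n. (\<Sum>j<n. g (seq_shift (j * m) x)) / real n \<le> (\<integral>x. g x \<partial>S) + 2 / Suc q) sequentially"
    if g: "integrable S g" for g :: "(nat \<Rightarrow> 'a) \<Rightarrow> real"
  proof (subst AE_all_countable, intro allI)
    fix q :: nat
    let ?J = "\<integral>x. g x \<partial>S" let ?e = "1 / real (Suc q)"
    have "(\<integral>x. g x - ?J - ?e \<partial>S) = - ?e"
      using g P.prob_space by (simp add: Bochner_Integration.integral_diff)
    then have "AE x in S. \<exists>K. \<forall>n. (\<Sum>j<n. g (seq_shift (j * m) x) - ?J - ?e) \<le> K"
      using g by (intro bounded_sums_shift m) auto
    then show "AE x in S. eventually (\<lambda>n. (\<Sum>j<n. g (seq_shift (j * m) x)) / real n \<le> ?J + 2 / Suc q) sequentially"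
    proof eventually_elim
      case (elim x)
      then obtain K where K: "\<And>n. (\<Sum>j<n. g (seq_shift (j * m) x) - ?J - ?e) \<le> K" by auto
      have "(\<lambda>n. K / real n) \<longlonglongrightarrow> 0" by (rule lim_const_over_n)
      then have "eventually (\<lambda>n. K / real n < ?e) sequentially"
        by (rule order_tendstoD) auto
      moreover have "eventually (\<lambda>n::nat. n > 0) sequentially" by (rule eventually_gt_at_top)
      ultimately show ?case
      proof eventually_elim
        case (elim n)
        have "(\<Sum>j<n. g (seq_shift (j * m) x)) \<le> K + n * (?J + ?e)"
          using K[of n] by (simp add: sum_subtractf algebra_simps)
        then have "(\<Sum>j<n. g (seq_shift (j * m) x)) / n \<le> K / n + (?J + ?e)"
          using elim(2) by (simp add: pos_divide_le_eq distrib_left mult.commute)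
        also have "\<dots> \<le> ?J + 2 * ?e" using elim(1) by simp
        finally show ?case by simp
      qed
    qed
  qed
  from f have f': "integrable S (\<lambda>x. - f x)" by simp
  from upper[OF f] upper[OF f'] show ?thesis
  proof eventually_elim
    case (elim x)
    show ?case
    proof (rule tendstoI)
      fix e :: real assume "0 < e"
      then obtain q where q: "2 / real (Suc q) < e"
        using reals_Archimedean[of "e/2"] by (auto simp: field_simps)
      from elim(1)[rule_format, of q] elim(2)[rule_format, of q]
      show "eventually (\<lambda>n. dist ((\<Sum>j<n. f (seq_shift (j * m) x)) / real n) ?I < e) sequentially"
        by eventually_elim (use q in \<open>auto simp: dist_real_def sum_negf abs_less_iff\<close>)
    qed
  qed
qed

lemma strong_law:
  fixes f :: "'a \<Rightarrow> real"
  assumes f: "integrable M f"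
  shows "AE x in S. (\<lambda>n. (\<Sum>i<n. f (x i)) / real n) \<longlonglongrightarrow> (\<integral>x. f x \<partial>M)"
proof -
  have [measurable]: "f \<in> borel_measurable M" using f by simp
  have d: "distr S M (\<lambda>x. x 0) = M" using PiM_component[of 0] by simp
  have "integrable S (\<lambda>x. f (x 0))"
    using f integrable_distr_eq[of "\<lambda>x. x 0" S M f] by (simp add: d)
  from ergodic_average[OF this, of 1] show ?thesis
    using integral_distr[of "\<lambda>x. x 0" S M f] by (simp add: d seq_shift_def)
qed

end

section \<open>Signed sums and entropy\<close>

text \<open>Sign vectors are coded by subsets, so that an expectation over random signs is a finite
  sum over \<open>Pow {..<n}\<close> divided by \<open>2 ^ n\<close>, without a further probability
  space.\<close>

definition rademacher :: "nat set \<Rightarrow> nat \<Rightarrow> real" where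
  "rademacher J i = (if i \<in> J then 1 else - 1)"

text \<open>The quantity whose measurability \<open>sup_measurable_class\<close> asserts. Free
  weights \<open>a\<close> let signed averages and differences of two sample means share it.\<close>

definition lin_sup :: "('a \<Rightarrow> real) set \<Rightarrow> (nat \<Rightarrow> real) \<Rightarrow> nat \<Rightarrow> (nat \<Rightarrow> 'a) \<Rightarrow> ennreal" where
  "lin_sup F a n x = (SUP f\<in>F. ennreal \<bar>\<Sum>i<n. a i * f (x i)\<bar>)"

text \<open>Hoeffding's lemma for a fair sign: \<open>Hoeffdings_lemma_aux\<close> with probability
  1/2 and step \<open>2 * y\<close>. The step must be nonnegative; evenness in \<open>x\<close>
  covers the rest.\<close>

lemma exp_plus_exp_minus_le: "exp x + exp (- x) \<le> 2 * exp (x\<^sup>2 / 2)" for x :: real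
proof -
  have main: "exp y + exp (- y) \<le> 2 * exp (y\<^sup>2 / 2)" if "0 \<le> y" for y :: real
  proof -
    have eq: "1 + (1/2) * (exp (2 * y) - 1) = exp y * ((exp y + exp (- y)) / 2)"
      by (simp add: field_simps flip: exp_add)
    have "- (2 * y) * (1/2) + ln (1 + (1/2) * (exp (2 * y) - 1)) \<le> (2 * y)\<^sup>2 / 8"
      using that by (intro Hoeffdings_lemma_aux) auto
    moreover have pos: "0 < (exp y + exp (- y)) / 2" by (simp add: add_pos_pos)
    then have "ln (exp y * ((exp y + exp (- y)) / 2)) = y + ln ((exp y + exp (- y)) / 2)"
      by (subst ln_mult_pos) auto
    ultimately have "ln ((exp y + exp (- y)) / 2) \<le> y\<^sup>2 / 2"
      unfolding eq by (simp add: power2_eq_square)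
    then have "(exp y + exp (- y)) / 2 \<le> exp (y\<^sup>2 / 2)"
      using pos by (metis exp_le_cancel_iff exp_ln)
    then show ?thesis by simp
  qed
  show ?thesis using main[of x] main[of "- x"] by (cases "0 \<le> x") (auto simp: add.commute)
qed

text \<open>Independence of the signs in finite form: expanding the product of the factors
  \<open>exp (c i) + exp (- c i)\<close> yields one term for each subset.\<close>

lemma sum_exp_sign_le:
  "(\<Sum>J\<in>Pow {..<n}. exp (\<Sum>i<n. rademacher J i * c i)) \<le> 2 ^ n * exp ((\<Sum>i<n. (c i)\<^sup>2) / 2)"
proof -
  have "(\<Sum>J\<in>Pow {..<n}. exp (\<Sum>i<n. rademacher J i * c i))
      = (\<Sum>J\<in>Pow {..<n}. (\<Prod>i\<in>J. exp (c i)) * (\<Prod>i\<in>{..<n} - J. exp (- c i)))"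
  proof (rule sum.cong)
    fix J assume "J \<in> Pow {..<n}"
    then have J: "J \<subseteq> {..<n}" by simp
    then have fin: "finite J" by (rule finite_subset) simp
    have "(\<Sum>i<n. rademacher J i * c i) = (\<Sum>i\<in>J. rademacher J i * c i) + (\<Sum>i\<in>{..<n} - J. rademacher J i * c i)"
      using sum.subset_diff[OF J, of "\<lambda>i. rademacher J i * c i"] by simp
    also have "\<dots> = (\<Sum>i\<in>J. c i) + (\<Sum>i\<in>{..<n} - J. - c i)"
      by (intro arg_cong2[where f="(+)"] sum.cong) (auto simp: rademacher_def)
    finally show "exp (\<Sum>i<n. rademacher J i * c i) = (\<Prod>i\<in>J. exp (c i)) * (\<Prod>i\<in>{..<n} - J. exp (- c i))"
      using fin by (simp add: exp_add exp_sum)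
  qed simp
  also have "\<dots> = (\<Prod>i<n. exp (c i) + exp (- c i))"
    by (rule prod_add[symmetric]) simp
  also have "\<dots> \<le> (\<Prod>i<n. 2 * exp ((c i)\<^sup>2 / 2))"
    by (intro prod_mono) (auto simp: exp_plus_exp_minus_le intro: add_nonneg_nonneg)
  also have "\<dots> = 2 ^ n * exp ((\<Sum>i<n. (c i)\<^sup>2) / 2)"
    by (simp add: prod.distrib exp_sum sum_divide_distrib)
  finally show ?thesis .
qed

text \<open>Massart's finite class lemma; instead of Jensen's inequality, \<open>\<eta> t \<le> a + exp (\<eta> t - a) - 1\<close>
  is averaged over all rademacher vectors.\<close>

lemma sum_signs_finite_class:
  fixes T :: "nat set \<Rightarrow> real"
  assumes C: "finite C" "C \<noteq> {}" and bd: "\<And>c i. c \<in> C \<Longrightarrow> i < n \<Longrightarrow> \<bar>c i\<bar> \<le> K"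
    and T: "\<And>J. J \<subseteq> {..<n} \<Longrightarrow> \<exists>c\<in>C. T J \<le> \<bar>\<Sum>i<n. rademacher J i * c i\<bar>"
    and \<eta>: "0 < \<eta>"
  shows "(\<Sum>J\<in>Pow {..<n}. T J) \<le> 2 ^ n * ((ln (2 * card C) + n * \<eta>\<^sup>2 * K\<^sup>2 / 2) / \<eta>)"
proof -
  \<comment> \<open>\<open>exp a\<close> will bound the average of
    \<open>exp (\<eta> * T J)\<close>. The 2 beside \<open>card C\<close> pays for replacing the
    absolute value by the two signs \<open>s\<close>.\<close>
  define a where "a = ln (2 * card C) + n * \<eta>\<^sup>2 * K\<^sup>2 / 2"
  have cpos: "0 < card C" using C by (simp add: card_gt_0_iff)
  have one: "(\<Sum>J\<in>Pow {..<n}. exp (\<Sum>i<n. rademacher J i * (s * \<eta> * c i))) \<le> 2 ^ n * exp (n * \<eta>\<^sup>2 * K\<^sup>2 / 2)"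
    if "c \<in> C" "s = 1 \<or> s = - 1" for c and s :: real
  proof -
    have "(\<Sum>i<n. (s * \<eta> * c i)\<^sup>2) \<le> (\<Sum>i<n. \<eta>\<^sup>2 * K\<^sup>2)"
    proof (rule sum_mono)
      fix i assume "i \<in> {..<n}"
      then have "\<bar>c i\<bar>\<^sup>2 \<le> K\<^sup>2" using bd[OF that(1)] by (intro power_mono) auto
      then show "(s * \<eta> * c i)\<^sup>2 \<le> \<eta>\<^sup>2 * K\<^sup>2"
        using that(2) mult_left_mono[of "(c i)\<^sup>2" "K\<^sup>2" "\<eta>\<^sup>2"] by (auto simp: power_mult_distrib)
    qed
    then have "exp ((\<Sum>i<n. (s * \<eta> * c i)\<^sup>2) / 2) \<le> exp (n * \<eta>\<^sup>2 * K\<^sup>2 / 2)" by (simp add: mult.assoc)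
    then have "2 ^ n * exp ((\<Sum>i<n. (s * \<eta> * c i)\<^sup>2) / 2) \<le> 2 ^ n * exp (n * \<eta>\<^sup>2 * K\<^sup>2 / 2)"
      by (intro mult_left_mono) auto
    with sum_exp_sign_le[where n=n and c="\<lambda>i. s * \<eta> * c i"] show ?thesis by linarith
  qed
  have expT: "exp (\<eta> * T J) \<le> (\<Sum>c\<in>C. exp (\<Sum>i<n. rademacher J i * (1 * \<eta> * c i)) + exp (\<Sum>i<n. rademacher J i * (-1 * \<eta> * c i)))"
    (is "_ \<le> (\<Sum>c\<in>C. ?g c)") if "J \<in> Pow {..<n}" for J
  proof -
    from T[of J] that obtain c where c: "c \<in> C" "T J \<le> \<bar>\<Sum>i<n. rademacher J i * c i\<bar>" by auto
    let ?s = "\<Sum>i<n. rademacher J i * c i"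
    have eq: "(\<Sum>i<n. rademacher J i * (s * \<eta> * c i)) = s * (\<eta> * ?s)" for s
      by (simp add: sum_distrib_left mult_ac)
    have "\<eta> * T J \<le> \<eta> * \<bar>?s\<bar>" using c \<eta> by simp
    then have "exp (\<eta> * T J) \<le> exp (\<eta> * \<bar>?s\<bar>)" by simp
    also have "\<dots> \<le> ?g c"
      unfolding eq by (cases "0 \<le> ?s") auto
    also have "\<dots> \<le> (\<Sum>c\<in>C. ?g c)"
      using c C by (intro member_le_sum) (auto intro: add_nonneg_nonneg)
    finally show ?thesis .
  qed
  have "(\<Sum>J\<in>Pow {..<n}. exp (\<eta> * T J))
      \<le> (\<Sum>J\<in>Pow {..<n}. \<Sum>c\<in>C. exp (\<Sum>i<n. rademacher J i * (1 * \<eta> * c i)) + exp (\<Sum>i<n. rademacher J i * (-1 * \<eta> * c i)))"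
    by (rule sum_mono) (rule expT)
  also have "\<dots> = (\<Sum>c\<in>C. (\<Sum>J\<in>Pow {..<n}. exp (\<Sum>i<n. rademacher J i * (1 * \<eta> * c i)))
       + (\<Sum>J\<in>Pow {..<n}. exp (\<Sum>i<n. rademacher J i * (-1 * \<eta> * c i))))"
    by (subst sum.swap) (simp add: sum.distrib)
  also have "\<dots> \<le> (\<Sum>c\<in>C. 2 ^ n * exp (n * \<eta>\<^sup>2 * K\<^sup>2 / 2) + 2 ^ n * exp (n * \<eta>\<^sup>2 * K\<^sup>2 / 2))"
    by (intro sum_mono add_mono one) auto
  also have "\<dots> = 2 ^ n * exp a"
    using cpos by (simp add: a_def exp_add)
  finally have sumexp: "(\<Sum>J\<in>Pow {..<n}. exp (\<eta> * T J)) \<le> 2 ^ n * exp a" .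
  have "(\<Sum>J\<in>Pow {..<n}. \<eta> * T J) \<le> (\<Sum>J\<in>Pow {..<n}. (a - 1) + exp (- a) * exp (\<eta> * T J))"
  proof (rule sum_mono)
    fix J
    have "1 + (\<eta> * T J - a) \<le> exp (\<eta> * T J - a)" by (rule exp_ge_add_one_self)
    then show "\<eta> * T J \<le> (a - 1) + exp (- a) * exp (\<eta> * T J)"
      by (simp add: mult_exp_exp algebra_simps)
  qed
  also have "\<dots> = 2 ^ n * (a - 1) + exp (- a) * (\<Sum>J\<in>Pow {..<n}. exp (\<eta> * T J))"
    by (simp add: sum.distrib card_Pow sum_distrib_left)
  also have "\<dots> \<le> 2 ^ n * (a - 1) + exp (- a) * (2 ^ n * exp a)"
    by (intro add_left_mono mult_left_mono sumexp) simp
  also have "\<dots> = 2 ^ n * a" by (simp add: exp_minus field_simps)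
  finally have "\<eta> * (\<Sum>J\<in>Pow {..<n}. T J) \<le> 2 ^ n * a" by (simp add: sum_distrib_left)
  then have "(\<Sum>J\<in>Pow {..<n}. T J) \<le> 2 ^ n * a / \<eta>"
    using \<eta> by (simp add: pos_le_divide_eq mult.commute)
  then show ?thesis by (simp add: a_def)
qed

section \<open>From covers of the class to signed sums over a fixed sample\<close>

lemma Inf_enat_mem:
  fixes A :: "enat set"
  assumes "Inf A \<noteq> \<infinity>"
  shows "Inf A \<in> A"
proof -
  from assms obtain a where "a \<in> A" by (auto simp: Inf_enat_def split: if_splits)
  then show ?thesis unfolding Inf_enat_def by (auto intro: LeastI)
qed

text \<open>The covering number is an infimum of natural numbers, so if finite it is attained. A
  nonempty class excludes the covering number 0, where \<open>ext_ln\<close> and \<open>ln\<close>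
  differ.\<close>

lemma metric_entropy_leE:
  assumes "F \<noteq> {}" and le: "metric_entropy \<delta> F R \<le> ereal b"
  obtains C where "finite C" "C \<noteq> {}" "ln (card C) \<le> b"
    "\<And>f. f \<in> F \<Longrightarrow> \<exists>c\<in>C. (\<integral>\<^sup>+x. ennreal \<bar>f x - c x\<bar> \<partial>R) \<le> ennreal \<delta>"
proof -
  let ?A = "{C. finite C \<and> (\<forall>c\<in>C. integrable R c) \<and>
                (\<forall>f\<in>F. \<exists>c\<in>C. (\<integral>\<^sup>+x. ennreal \<bar>f x - c x\<bar> \<partial>R) \<le> ennreal \<delta>)}"
  let ?cards = "(\<lambda>C. enat (card C)) ` ?A"
  have cov: "covering_number \<delta> F R = Inf ?cards" by (simp add: covering_number_def)
  from le have "covering_number \<delta> F R \<noteq> \<infinity>"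
    by (auto simp: metric_entropy_def split: enat.splits)
  then have "Inf ?cards \<in> ?cards" unfolding cov by (rule Inf_enat_mem)
  then obtain C where C: "C \<in> ?A" "covering_number \<delta> F R = enat (card C)" unfolding cov by auto
  from \<open>F \<noteq> {}\<close> obtain f where "f \<in> F" by auto
  with C(1) have ne: "C \<noteq> {}" by blast
  with C have "0 < card C" by (auto simp: card_gt_0_iff)
  with le C(2) have "ln (card C) \<le> b" by (auto simp: metric_entropy_def ext_ln_def)
  with C ne show ?thesis by (intro that[of C]) auto
qed

lemma clip_dist: "\<bar>u\<bar> \<le> K \<Longrightarrow> \<bar>u - max (- K) (min K v)\<bar> \<le> \<bar>u - v\<bar>" for u v K :: real
  by (auto simp: max_def min_def)

text \<open>Three errors are separated: passing from \<open>f\<close> to a centre of the cover costs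
  \<delta> on average, observations with a large envelope cost the average of \<open>B\<close> over
  them, and the clipped centres are a finite class of vectors bounded by \<open>K\<close>, for which
  \<open>sum_signs_finite_class\<close> holds.\<close>

lemma sum_signs_entropy:
  fixes F :: "('a \<Rightarrow> real) set" and x :: "nat \<Rightarrow> 'a"
  assumes "F \<noteq> {}" and n: "0 < n" and \<delta>: "0 < \<delta>" and \<eta>: "0 < \<eta>" and K: "0 \<le> K"
    and ent: "metric_entropy \<delta> F (empirical n x) / ereal (real n) \<le> ereal \<epsilon>"
    and bd: "\<And>f i. f \<in> F \<Longrightarrow> i < n \<Longrightarrow> \<bar>f (x i)\<bar> \<le> B (x i)"
  shows "(\<Sum>J\<in>Pow {..<n}. lin_sup F (\<lambda>i. rademacher J i / n) n x)
    \<le> ennreal (2 ^ n * (\<delta> + (ln 2 / n + \<epsilon>) / \<eta> + \<eta> * K\<^sup>2 / 2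
         + (\<Sum>i<n. B (x i) * indicator {y. K < B y} (x i)) / n))"
proof -
  from ent n have "metric_entropy \<delta> F (empirical n x) \<le> ereal (n * \<epsilon>)"
    by (subst (asm) ereal_divide_le_pos) (auto simp: mult.commute)
  from metric_entropy_leE[OF \<open>F \<noteq> {}\<close> this] obtain C where C: "finite C" "C \<noteq> {}"
    and lnC: "ln (card C) \<le> n * \<epsilon>"
    and cov: "\<And>f. f \<in> F \<Longrightarrow> \<exists>c\<in>C. (\<integral>\<^sup>+y. ennreal \<bar>f y - c y\<bar> \<partial>(empirical n x)) \<le> ennreal \<delta>"
    by metis
  \<comment> \<open>The centres are arbitrary integrable functions. Clipping bounds them and takes
    them no further from any value of modulus at most \<open>K\<close>; where the envelope exceeds
    \<open>K\<close>, the value 0 leaves an error of at most \<open>B\<close>. The argument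
    \<open>i\<close> is a position in the sample because \<open>sum_signs_finite_class\<close> is
    about vectors.\<close>
  define clip where "clip c i = (if K < B (x i) then 0 else max (- K) (min K (c (x i))))" for c :: "'a \<Rightarrow> real" and i
  define r where "r = (\<Sum>i<n. B (x i) * indicator {y. K < B y} (x i))"
  define T where "T J = Max ((\<lambda>c. \<bar>\<Sum>i<n. rademacher J i * clip c i\<bar>) ` C)" for J
  have T_mem: "T J \<in> (\<lambda>c. \<bar>\<Sum>i<n. rademacher J i * clip c i\<bar>) ` C" for J
    unfolding T_def using C by (intro Max_in) auto
  have T_nonneg: "0 \<le> T J" for J
    by (rule imageE[OF T_mem[of J]]) simp
  have "(\<Sum>J\<in>Pow {..<n}. T J) \<le> 2 ^ n * ((ln (2 * card (clip ` C)) + n * \<eta>\<^sup>2 * K\<^sup>2 / 2) / \<eta>)"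
  proof (rule sum_signs_finite_class)
    show "\<exists>c\<in>clip ` C. T J \<le> \<bar>\<Sum>i<n. rademacher J i * c i\<bar>" for J
      using T_mem[of J] by auto
    show "\<bar>c i\<bar> \<le> K" if "c \<in> clip ` C" for c i
      using that K by (auto simp: clip_def)
  qed (use C \<eta> in auto)
  also have "\<dots> \<le> 2 ^ n * ((ln 2 + n * \<epsilon> + n * \<eta>\<^sup>2 * K\<^sup>2 / 2) / \<eta>)"
  proof -
    have "0 < card (clip ` C)" using C by (simp add: card_gt_0_iff)
    moreover have "card (clip ` C) \<le> card C" using C by (intro card_image_le) auto
    ultimately have "ln (2 * card (clip ` C)) \<le> ln 2 + ln (card C)"
      by (simp add: ln_mult)
    with lnC \<eta> show ?thesis by (intro mult_left_mono divide_right_mono) auto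
  qed
  finally have sumT: "(\<Sum>J\<in>Pow {..<n}. T J) \<le> 2 ^ n * ((ln 2 + n * \<epsilon> + n * \<eta>\<^sup>2 * K\<^sup>2 / 2) / \<eta>)" .
  have r_nonneg: "0 \<le> r"
    unfolding r_def using K by (intro sum_nonneg) (auto simp: indicator_def)
  have each: "lin_sup F (\<lambda>i. rademacher J i / n) n x \<le> ennreal ((r + n * \<delta> + T J) / n)" for J
    unfolding lin_sup_def
  proof (rule SUP_least, rule ennreal_leI)
    fix f assume f: "f \<in> F"
    from cov[OF f] obtain c where c: "c \<in> C"
      and "(\<integral>\<^sup>+y. ennreal \<bar>f y - c y\<bar> \<partial>(empirical n x)) \<le> ennreal \<delta>" by auto
    then have "(\<Sum>i<n. ennreal \<bar>f (x i) - c (x i)\<bar>) / n \<le> ennreal \<delta>"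
      using n by (simp add: empirical_def nn_integral_pmf_of_set lessThan_empty_iff)
    then have "ennreal ((\<Sum>i<n. \<bar>f (x i) - c (x i)\<bar>) / n) \<le> ennreal \<delta>"
      using n by (simp add: sum_ennreal sum_nonneg ennreal_of_nat_eq_real_of_nat flip: divide_ennreal)
    then have cn: "(\<Sum>i<n. \<bar>f (x i) - c (x i)\<bar>) \<le> n * \<delta>"
      using n \<delta> by (subst (asm) ennreal_le_iff) (auto simp: field_simps)
    have "\<bar>\<Sum>i<n. rademacher J i * f (x i)\<bar>
        = \<bar>(\<Sum>i<n. rademacher J i * (f (x i) - clip c i)) + (\<Sum>i<n. rademacher J i * clip c i)\<bar>"
      by (simp add: algebra_simps sum_subtractf)
    also have "\<dots> \<le> \<bar>\<Sum>i<n. rademacher J i * (f (x i) - clip c i)\<bar> + \<bar>\<Sum>i<n. rademacher J i * clip c i\<bar>"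
      by (rule abs_triangle_ineq)
    also have "\<bar>\<Sum>i<n. rademacher J i * (f (x i) - clip c i)\<bar> \<le> (\<Sum>i<n. \<bar>rademacher J i * (f (x i) - clip c i)\<bar>)"
      by (rule sum_abs)
    also have "\<dots> \<le> (\<Sum>i<n. B (x i) * indicator {y. K < B y} (x i) + \<bar>f (x i) - c (x i)\<bar>)"
    proof (rule sum_mono)
      fix i assume "i \<in> {..<n}"
      then have "\<bar>f (x i)\<bar> \<le> B (x i)" using bd[OF f] by auto
      moreover have "\<bar>rademacher J i * (f (x i) - clip c i)\<bar> = \<bar>f (x i) - clip c i\<bar>"
        by (simp add: rademacher_def abs_mult)
      ultimately show "\<bar>rademacher J i * (f (x i) - clip c i)\<bar> \<le> B (x i) * indicator {y. K < B y} (x i) + \<bar>f (x i) - c (x i)\<bar>"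
        using clip_dist[of "f (x i)" K "c (x i)"] by (cases "K < B (x i)") (auto simp: clip_def)
    qed
    also have "\<dots> \<le> r + n * \<delta>" using cn by (simp add: sum.distrib r_def)
    also have "\<bar>\<Sum>i<n. rademacher J i * clip c i\<bar> \<le> T J"
      unfolding T_def using C c by (intro Max_ge) auto
    finally have le: "\<bar>\<Sum>i<n. rademacher J i * f (x i)\<bar> \<le> r + n * \<delta> + T J" by simp
    have "(\<Sum>i<n. rademacher J i / n * f (x i)) = (\<Sum>i<n. rademacher J i * f (x i)) / n"
      by (simp add: sum_divide_distrib)
    then show "\<bar>\<Sum>i<n. rademacher J i / n * f (x i)\<bar> \<le> (r + n * \<delta> + T J) / n"
      using le n by (simp add: divide_right_mono)
  qed
  have "(\<Sum>J\<in>Pow {..<n}. lin_sup F (\<lambda>i. rademacher J i / n) n x) \<le> (\<Sum>J\<in>Pow {..<n}. ennreal ((r + n * \<delta> + T J) / n))"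
    by (rule sum_mono) (rule each)
  also have "\<dots> = ennreal (\<Sum>J\<in>Pow {..<n}. (r + n * \<delta> + T J) / n)"
    using r_nonneg T_nonneg \<delta> by (intro sum_ennreal) auto
  also have "\<dots> \<le> ennreal (2 ^ n * (\<delta> + (ln 2 / n + \<epsilon>) / \<eta> + \<eta> * K\<^sup>2 / 2 + r / n))"
  proof (rule ennreal_leI)
    have "(\<Sum>J\<in>Pow {..<n}. (r + n * \<delta> + T J) / n) = (2 ^ n * (r + n * \<delta>) + (\<Sum>J\<in>Pow {..<n}. T J)) / n"
      by (simp add: sum.distrib card_Pow flip: sum_divide_distrib)
    also have "\<dots> \<le> (2 ^ n * (r + n * \<delta>) + 2 ^ n * ((ln 2 + n * \<epsilon> + n * \<eta>\<^sup>2 * K\<^sup>2 / 2) / \<eta>)) / n"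
      using sumT by (intro divide_right_mono add_left_mono) auto
    also have "\<dots> = 2 ^ n * (\<delta> + (ln 2 / n + \<epsilon>) / \<eta> + \<eta> * K\<^sup>2 / 2 + r / n)"
      using n \<eta> by (simp add: field_simps power2_eq_square)
    finally show "(\<Sum>J\<in>Pow {..<n}. (r + n * \<delta> + T J) / n) \<le> \<dots>" .
  qed
  finally show ?thesis unfolding r_def .
qed

section \<open>Symmetrization\<close>

text \<open>Turns \<open>lin_sup F (ghost m) (m + m)\<close> into the largest difference between the
  mean of the first \<open>m\<close> observations and that of the next \<open>m\<close>, the ghost
  sample.\<close>

definition ghost :: "nat \<Rightarrow> nat \<Rightarrow> real" where
  "ghost m i = (if i < m then 1 / m else - 1 / m)"

lemma sum_lessThan_add:
  fixes g :: "nat \<Rightarrow> 'b::comm_monoid_add"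
  shows "(\<Sum>i<m + k. g i) = (\<Sum>i<m. g i) + (\<Sum>i<k. g (i + m))"
  by (induction k) (auto simp: add_ac)

lemma sum_lessThan_blocks:
  fixes g :: "nat \<Rightarrow> 'b::comm_monoid_add"
  shows "(\<Sum>i<k * m + r. g i) = (\<Sum>j<k. \<Sum>i<m. g (i + j * m)) + (\<Sum>i<r. g (i + k * m))"
proof -
  have "(\<Sum>i<k * m. g i) = (\<Sum>j<k. \<Sum>i<m. g (i + j * m))"
  proof (induction k)
    case (Suc k)
    have "Suc k * m = k * m + m" by simp
    then show ?case using Suc by (simp only: sum_lessThan_add) simp
  qed simp
  then show ?thesis by (simp add: sum_lessThan_add)
qed

lemma lin_sup_cong:
  "(\<And>i. i < n \<Longrightarrow> x i = y i) \<Longrightarrow> lin_sup F a n x = lin_sup F a n y"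
  unfolding lin_sup_def by (intro SUP_cong refl arg_cong[where f=ennreal] arg_cong[where f=abs] sum.cong) auto

context sequence_space
begin

lemma integral_component:
  fixes f :: "'a \<Rightarrow> real"
  assumes f: "integrable M f"
  shows "integrable S (\<lambda>x. f (x i))" "(\<integral>x. f (x i) \<partial>S) = (\<integral>y. f y \<partial>M)"
proof -
  have [measurable]: "f \<in> borel_measurable M" using f by simp
  have d: "distr S M (\<lambda>x. x i) = M" using PiM_component[of i] by simp
  show "integrable S (\<lambda>x. f (x i))"
    using f integrable_distr_eq[of "\<lambda>x. x i" S M f] by (simp add: d)
  show "(\<integral>x. f (x i) \<partial>S) = (\<integral>y. f y \<partial>M)"
    using integral_distr[of "\<lambda>x. x i" S M f] by (simp add: d)
qed

lemma AE_shift: "AE x in S. P x \<Longrightarrow> AE x in S. P (seq_shift m x)"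
  by (rule AE_distrD[where f="seq_shift m" and P=P and M'=S]) (simp_all only: distr_shift measurable_shift)

text \<open>\<open>g\<close> will be a supremum that is measurable only for a completion, so the
  change of variables goes through its Borel version \<open>g'\<close>. The exceptional null set
  stays null because the rearrangement preserves the law.\<close>

lemma nn_integral_reindex:
  fixes g :: "(nat \<Rightarrow> 'a) \<Rightarrow> ennreal"
  assumes [measurable]: "g' \<in> borel_measurable S" and ae: "AE x in S. g x = g' x" and f: "inj f"
  shows "(\<integral>\<^sup>+x. g (\<lambda>i. x (f i)) \<partial>S) = (\<integral>\<^sup>+x. g x \<partial>S)"
proof -
  have "AE x in S. g (\<lambda>i. x (f i)) = g' (\<lambda>i. x (f i))"
    using AE_distrD[OF measurable_reindex[of f], of "\<lambda>y. g y = g' y"] ae by (simp only: distr_reindex[OF f])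
  then have "(\<integral>\<^sup>+x. g (\<lambda>i. x (f i)) \<partial>S) = (\<integral>\<^sup>+x. g' (\<lambda>i. x (f i)) \<partial>S)"
    by (rule nn_integral_cong_AE)
  also have "\<dots> = (\<integral>\<^sup>+x. g' x \<partial>(distr S S (\<lambda>x i. x (f i))))"
    by (rule nn_integral_distr[symmetric, OF measurable_reindex]) simp
  also have "\<dots> = (\<integral>\<^sup>+x. g x \<partial>S)"
    unfolding distr_reindex[OF f] using ae by (intro nn_integral_cong_AE) auto
  finally show ?thesis .
qed

text \<open>The supremum looks at the first \<open>n\<close> coordinates only, so a Borel version on
  the finite product is pulled back along the projection.\<close>

lemma lin_sup_borel:
  assumes "sup_measurable_class M F"
  shows "\<exists>g\<in>borel_measurable S. AE x in S. lin_sup F a n x = g x"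
proof -
  have "lin_sup F a n \<in> borel_measurable (completion (PiM {..<n} (\<lambda>_. M)))"
    using assms unfolding sup_measurable_class_def lin_sup_def[abs_def] by auto
  from completion_ex_borel_measurable[OF this] obtain g
    where [measurable]: "g \<in> borel_measurable (PiM {..<n} (\<lambda>_. M))"
      and g: "AE x in PiM {..<n} (\<lambda>_. M). lin_sup F a n x = g x" by auto
  have d: "distr S (PiM {..<n} (\<lambda>_. M)) (\<lambda>x. \<lambda>i\<in>{..<n}. x i) = PiM {..<n} (\<lambda>_. M)"
    using distr_PiM_reindex[of UNIV "\<lambda>_. M" "\<lambda>i. i" "{..<n}"] by (simp add: M.prob_space_axioms)
  have [measurable]: "(\<lambda>x. \<lambda>i\<in>{..<n}. x i) \<in> measurable S (PiM {..<n} (\<lambda>_. M))"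
    by measurable
  have "AE x in S. lin_sup F a n (\<lambda>i\<in>{..<n}. x i) = g (\<lambda>i\<in>{..<n}. x i)"
    by (rule AE_distrD[where f="\<lambda>x. \<lambda>i\<in>{..<n}. x i" and P="\<lambda>y. lin_sup F a n y = g y"
          and M'="PiM {..<n} (\<lambda>_. M)"]) (use g in \<open>simp_all only: d, measurable\<close>)
  moreover have "lin_sup F a n (\<lambda>i\<in>{..<n}. x i) = lin_sup F a n x" for x
    by (rule lin_sup_cong) simp
  ultimately show ?thesis
    by (intro bexI[of _ "\<lambda>x. g (\<lambda>i\<in>{..<n}. x i)"]) auto
qed

text \<open>Exchanging \<open>x i\<close> with its ghost copy \<open>x (i + m)\<close> for \<open>i \<notin> J\<close> preserves the law of the
  sample and produces the signs \<open>rademacher J\<close>.\<close>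

lemma symmetrization:
  assumes F: "sup_measurable_class M F" and m: "0 < m"
  shows "(\<integral>\<^sup>+x. lin_sup F (ghost m) (m + m) x \<partial>S) \<le> 2 * (\<integral>\<^sup>+x. lin_sup F (\<lambda>i. rademacher J i / m) m x \<partial>S)"
proof -
  define \<pi> where "\<pi> i = (if i < m \<and> i \<notin> J then i + m
      else if m \<le> i \<and> i < m + m \<and> i - m \<notin> J then i - m else i)" for i
  have inj: "inj \<pi>"
    by (rule injI) (auto simp: \<pi>_def split: if_splits)
  let ?T = "lin_sup F (ghost m) (m + m)" and ?A = "lin_sup F (\<lambda>i. rademacher J i / m) m"
  obtain T' where T': "T' \<in> borel_measurable S" "AE x in S. ?T x = T' x"
    using lin_sup_borel[OF F] by metis
  obtain A' where A'[measurable]: "A' \<in> borel_measurable S" and A'_eq: "AE x in S. ?A x = A' x"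
    using lin_sup_borel[OF F] by metis
  \<comment> \<open>After the exchange, the difference of means is a signed average of the sample
    minus the same signed average of its ghost copy. Both have the same law, whence the factor
    2.\<close>
  have pointwise: "?T (\<lambda>i. x (\<pi> i)) \<le> ?A x + ?A (seq_shift m x)" for x
    unfolding lin_sup_def[of F "ghost m"]
  proof (rule SUP_least)
    fix f assume f: "f \<in> F"
    let ?s = "\<lambda>y. \<Sum>i<m. rademacher J i / m * f (y i)"
    have "(\<Sum>i<m + m. ghost m i * f (x (\<pi> i)))
        = (\<Sum>i<m. ghost m i * f (x (\<pi> i)) + ghost m (i + m) * f (x (\<pi> (i + m))))"
      by (simp add: sum_lessThan_add sum.distrib)
    also have "\<dots> = (\<Sum>i<m. rademacher J i / m * f (x i) - rademacher J i / m * f (x (i + m)))"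
      by (rule sum.cong) (auto simp: ghost_def rademacher_def \<pi>_def)
    also have "\<dots> = ?s x - ?s (seq_shift m x)"
      by (simp add: sum_subtractf seq_shift_def)
    finally have "ennreal \<bar>\<Sum>i<m + m. ghost m i * f (x (\<pi> i))\<bar> \<le> ennreal (\<bar>?s x\<bar> + \<bar>?s (seq_shift m x)\<bar>)"
      by (intro ennreal_leI) simp
    also have "\<dots> = ennreal \<bar>?s x\<bar> + ennreal \<bar>?s (seq_shift m x)\<bar>" by (rule ennreal_plus) auto
    also have "\<dots> \<le> ?A x + ?A (seq_shift m x)"
      unfolding lin_sup_def using f by (intro add_mono SUP_upper2[of f]) auto
    finally show "ennreal \<bar>\<Sum>i<m + m. ghost m i * f (x (\<pi> i))\<bar> \<le> ?A x + ?A (seq_shift m x)" .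
  qed
  have "(\<integral>\<^sup>+x. ?T x \<partial>S) = (\<integral>\<^sup>+x. ?T (\<lambda>i. x (\<pi> i)) \<partial>S)"
    by (rule nn_integral_reindex[OF T' inj, symmetric])
  also have "\<dots> \<le> (\<integral>\<^sup>+x. ?A x + ?A (seq_shift m x) \<partial>S)"
    by (intro nn_integral_mono pointwise)
  also have "\<dots> = (\<integral>\<^sup>+x. A' x + A' (seq_shift m x) \<partial>S)"
    using A'_eq AE_shift[OF A'_eq, of m] by (intro nn_integral_cong_AE) (auto elim: eventually_elim2)
  also have "\<dots> = (\<integral>\<^sup>+x. A' x \<partial>S) + (\<integral>\<^sup>+x. A' (seq_shift m x) \<partial>S)"
    by (rule nn_integral_add) (auto intro: measurable_compose[OF measurable_shift])
  also have "(\<integral>\<^sup>+x. A' (seq_shift m x) \<partial>S) = (\<integral>\<^sup>+x. A' x \<partial>S)"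
    unfolding seq_shift_def by (rule nn_integral_reindex[of A']) (auto simp: inj_def)
  also have "(\<integral>\<^sup>+x. A' x \<partial>S) = (\<integral>\<^sup>+x. ?A x \<partial>S)"
    using A'_eq by (intro nn_integral_cong_AE) auto
  finally show ?thesis by (simp add: mult_2)
qed

text \<open>The mean under \<open>M\<close> is the expectation of the ghost mean, so the deviation
  is at most the ghost supremum averaged over the ghost sample. By Fubini's theorem this average
  \<open>u\<close> is measurable in \<open>x\<close>, and it dominates all \<open>f\<close> outside
  a single null set, however large the class.\<close>

lemma ghost_majorant:
  assumes F: "sup_measurable_class M F" and int: "\<And>f. f \<in> F \<Longrightarrow> integrable M f" and m: "0 < m"
  obtains u where "u \<in> borel_measurable S"
    "AE x in S. \<forall>f\<in>F. ennreal \<bar>(\<Sum>i<m. f (x i)) / m - (\<integral>y. f y \<partial>M)\<bar> \<le> u x"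
    "(\<integral>\<^sup>+x. u x \<partial>S) = (\<integral>\<^sup>+x. lin_sup F (ghost m) (m + m) x \<partial>S)"
proof -
  let ?T = "lin_sup F (ghost m) (m + m)"
  obtain T' where T'[measurable]: "T' \<in> borel_measurable S" and T'_eq: "AE x in S. ?T x = T' x"
    using lin_sup_borel[OF F] by metis
  define u where "u x = (\<integral>\<^sup>+y. T' (comb_seq m x y) \<partial>S)" for x
  have meas: "(\<lambda>(x, y). T' (comb_seq m x y)) \<in> borel_measurable (S \<Otimes>\<^sub>M S)"
    using measurable_compose[OF measurable_comb_seq T'] by (simp add: case_prod_unfold)
  have "u \<in> borel_measurable S"
    unfolding u_def[abs_def] using P.borel_measurable_nn_integral_fst[OF meas] by simp
  moreover have "(\<integral>\<^sup>+x. u x \<partial>S) = (\<integral>\<^sup>+x. ?T x \<partial>S)"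
  proof -
    have "(\<integral>\<^sup>+x. u x \<partial>S) = (\<integral>\<^sup>+z. (\<lambda>(x, y). T' (comb_seq m x y)) z \<partial>(S \<Otimes>\<^sub>M S))"
      unfolding u_def using P.nn_integral_fst[OF meas] by simp
    also have "\<dots> = (\<integral>\<^sup>+z. T' ((\<lambda>(x, y). comb_seq m x y) z) \<partial>(S \<Otimes>\<^sub>M S))"
      by (simp add: case_prod_unfold)
    also have "\<dots> = (\<integral>\<^sup>+x. T' x \<partial>(distr (S \<Otimes>\<^sub>M S) S (\<lambda>(x, y). comb_seq m x y)))"
      by (rule nn_integral_distr[symmetric, OF measurable_comb_seq]) simp
    also have "\<dots> = (\<integral>\<^sup>+x. ?T x \<partial>S)"
      unfolding PiM_comb_seq using T'_eq by (intro nn_integral_cong_AE) auto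
    finally show ?thesis .
  qed
  moreover have "AE x in S. \<forall>f\<in>F. ennreal \<bar>(\<Sum>i<m. f (x i)) / m - (\<integral>y. f y \<partial>M)\<bar> \<le> u x"
  proof -
    interpret PP: pair_sigma_finite S S ..
    have "AE z in S \<Otimes>\<^sub>M S. ?T ((\<lambda>(x, y). comb_seq m x y) z) = T' ((\<lambda>(x, y). comb_seq m x y) z)"
      using AE_distrD[OF measurable_comb_seq, of "\<lambda>z. ?T z = T' z"] T'_eq by (simp only: PiM_comb_seq)
    then have "AE x in S. AE y in S. ?T (comb_seq m x y) = T' (comb_seq m x y)"
      by (auto dest!: PP.AE_pair)
    then show ?thesis
    proof eventually_elim
      case (elim x)
      show ?case
      proof
        fix f assume f: "f \<in> F"
        let ?a = "(\<Sum>i<m. f (x i)) / m" and ?g = "\<lambda>y. (\<Sum>i<m. f (y i)) / m"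
        have g: "integrable S ?g" and Ig: "(\<integral>y. ?g y \<partial>S) = (\<integral>y. f y \<partial>M)"
          using integral_component[OF int[OF f]] m by (auto simp: Bochner_Integration.integral_sum)
        have "?a - (\<integral>y. f y \<partial>M) = (\<integral>y. ?a - ?g y \<partial>S)"
          using g Ig P.prob_space by (subst Bochner_Integration.integral_diff) auto
        then have "ennreal \<bar>?a - (\<integral>y. f y \<partial>M)\<bar> \<le> (\<integral>\<^sup>+y. ennreal \<bar>?a - ?g y\<bar> \<partial>S)"
          using integral_norm_bound_ennreal[of S "\<lambda>y. ?a - ?g y"] g by simp
        also have "\<dots> \<le> (\<integral>\<^sup>+y. ?T (comb_seq m x y) \<partial>S)"
        proof (rule nn_integral_mono)
          fix y
          have "(\<Sum>i<m + m. ghost m i * f (comb_seq m x y i)) = (\<Sum>i<m. 1 / m * f (x i)) + (\<Sum>i<m. - 1 / m * f (y i))"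
            unfolding sum_lessThan_add by (intro arg_cong2[where f="(+)"] sum.cong) (auto simp: ghost_def comb_seq_def)
          also have "\<dots> = ?a - ?g y"
            by (simp add: sum_divide_distrib sum_negf)
          finally show "ennreal \<bar>?a - ?g y\<bar> \<le> ?T (comb_seq m x y)"
            unfolding lin_sup_def using f by (intro SUP_upper2[of f]) auto
        qed
        also have "\<dots> = u x"
          unfolding u_def by (rule nn_integral_cong_AE[OF elim])
        finally show "ennreal \<bar>?a - (\<integral>y. f y \<partial>M)\<bar> \<le> u x" .
      qed
    qed
  qed
  ultimately show ?thesis using that by blast
qed

text \<open>Off the event of large entropy the estimate is \<open>sum_signs_entropy\<close>; on it
  every signed average is still at most \<open>K\<close> plus the tail average of \<open>B\<close>,
  which costs \<open>K * p\<close> in the mean. The outer factor 2 is that of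
  \<open>symmetrization\<close>.\<close>

lemma ghost_mean_bound:
  assumes F: "sup_measurable_class M F" "F \<noteq> {}" and m: "0 < m"
    and B: "integrable M B" "\<And>y. 0 \<le> B y" "AE y in M. \<forall>f\<in>F. \<bar>f y\<bar> \<le> B y"
    and pos: "0 < \<delta>" "0 < \<eta>" "0 \<le> K" "0 \<le> \<epsilon>" "0 \<le> p"
    and inner: "\<And>C. C \<in> sets S
        \<Longrightarrow> C \<subseteq> {x. \<not> metric_entropy \<delta> F (empirical m x) / ereal (real m) \<le> ereal \<epsilon>}
        \<Longrightarrow> emeasure S C \<le> ennreal p"
  shows "(\<integral>\<^sup>+x. lin_sup F (ghost m) (m + m) x \<partial>S)
    \<le> ennreal (2 * (\<delta> + (ln 2 / m + \<epsilon>) / \<eta> + \<eta> * K\<^sup>2 / 2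
         + (\<integral>y. B y * indicator {y. K < B y} y \<partial>M) + K * p))"
proof -
  have [measurable]: "B \<in> borel_measurable M" using B by simp
  let ?T = "lin_sup F (ghost m) (m + m)" and ?A = "\<lambda>J. lin_sup F (\<lambda>i. rademacher J i / m) m"
  define b where "b y = B y * indicator {y. K < B y} y" for y
  define c where "c = \<delta> + (ln 2 / m + \<epsilon>) / \<eta> + \<eta> * K\<^sup>2 / 2"
  have c: "0 \<le> c" using pos unfolding c_def by auto
  define r where "r x = (\<Sum>i<m. b (x i)) / m" for x
  have b_int: "integrable M b"
    unfolding b_def[abs_def] by (rule Bochner_Integration.integrable_bound[OF B(1)]) (auto simp: indicator_def B(2))
  have r_int: "integrable S r" and r_eq: "(\<integral>x. r x \<partial>S) = (\<integral>y. b y \<partial>M)"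
    unfolding r_def[abs_def] using integral_component[OF b_int] m
    by (auto simp: Bochner_Integration.integral_sum)
  have [measurable]: "r \<in> borel_measurable S" using r_int by simp
  have r_nonneg: "0 \<le> r x" for x
    unfolding r_def by (intro divide_nonneg_nonneg sum_nonneg) (auto simp: b_def B(2))
  have "\<exists>g. \<forall>J. g J \<in> borel_measurable S \<and> (AE x in S. ?A J x = g J x)"
    using lin_sup_borel[OF F(1)] by (intro choice) blast
  then obtain A' where A'[measurable]: "\<And>J. A' J \<in> borel_measurable S"
    and A'_eq: "\<And>J. AE x in S. ?A J x = A' J x" by auto
  define W where "W x = (\<Sum>J\<in>Pow {..<m}. A' J x)" for x
  have [measurable]: "W \<in> borel_measurable S" unfolding W_def[abs_def] by measurable
  have W_eq: "AE x in S. (\<Sum>J\<in>Pow {..<m}. ?A J x) = W x"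
  proof -
    have "AE x in S. \<forall>J\<in>Pow {..<m}. ?A J x = A' J x"
      using A'_eq by (intro AE_finite_allI) auto
    then show ?thesis by eventually_elim (auto simp: W_def intro: sum.cong)
  qed
  have B_all: "AE x in S. \<forall>i. \<forall>f\<in>F. \<bar>f (x i)\<bar> \<le> B (x i)"
    unfolding AE_all_countable using AE_component[OF _ B(3)] by auto
  \<comment> \<open>The measurable event on which the wanted estimate fails. Up to a null set it
    lies inside the event of large entropy, which is how \<open>inner\<close> becomes
    applicable.\<close>
  define C where "C = {x\<in>space S. ennreal (2 ^ m * (c + r x)) < W x}"
  have C: "C \<in> sets S" unfolding C_def by measurable
  have "emeasure S C \<le> ennreal p"
  proof -
    from B_all W_eq have "AE x in S. (\<Sum>J\<in>Pow {..<m}. ?A J x) = W x \<and> (\<forall>i. \<forall>f\<in>F. \<bar>f (x i)\<bar> \<le> B (x i))"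
      by eventually_elim auto
    then obtain N where N: "N \<in> null_sets S"
      "{x\<in>space S. \<not> ((\<Sum>J\<in>Pow {..<m}. ?A J x) = W x \<and> (\<forall>i. \<forall>f\<in>F. \<bar>f (x i)\<bar> \<le> B (x i)))} \<subseteq> N"
      by (rule AE_E3) (auto simp: Diff_subset_conv)
    have "C - N \<subseteq> {x. \<not> metric_entropy \<delta> F (empirical m x) / ereal (real m) \<le> ereal \<epsilon>}"
    proof (rule subsetI, rule CollectI, rule notI)
      fix x assume x: "x \<in> C - N" and ent: "metric_entropy \<delta> F (empirical m x) / ereal (real m) \<le> ereal \<epsilon>"
      from x N(2) have W: "(\<Sum>J\<in>Pow {..<m}. ?A J x) = W x" and "\<And>i f. f \<in> F \<Longrightarrow> \<bar>f (x i)\<bar> \<le> B (x i)"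
        by (auto simp: C_def)
      from sum_signs_entropy[OF F(2) m pos(1-3) ent, of B] this(2)
      have "W x \<le> ennreal (2 ^ m * (c + r x))"
        unfolding W c_def r_def b_def by simp
      with x show False by (auto simp: C_def)
    qed
    then have "emeasure S (C - N) \<le> ennreal p" using C N by (intro inner) auto
    then show ?thesis using emeasure_Diff_null_set[OF N(1) C] by simp
  qed
  have W_le: "AE x in S. W x \<le> ennreal (2 ^ m * (c + r x)) + ennreal (2 ^ m * K) * indicator C x"
    using B_all W_eq AE_space
  proof eventually_elim
    case (elim x)
    show ?case
    proof (cases "x \<in> C")
      case True
      have "?A J x \<le> ennreal (K + r x)" for J
        unfolding lin_sup_def
      proof (rule SUP_least, rule ennreal_leI)
        fix f assume f: "f \<in> F"
        have "\<bar>\<Sum>i<m. rademacher J i / m * f (x i)\<bar> \<le> (\<Sum>i<m. \<bar>rademacher J i / m * f (x i)\<bar>)" by (rule sum_abs)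
        also have "\<dots> \<le> (\<Sum>i<m. (K + b (x i)) / m)"
        proof (rule sum_mono)
          fix i
          have "\<bar>f (x i)\<bar> \<le> B (x i)" using elim f by auto
          then have "\<bar>f (x i)\<bar> \<le> K + b (x i)" using pos by (auto simp: b_def indicator_def)
          then have "\<bar>f (x i)\<bar> / m \<le> (K + b (x i)) / m" by (intro divide_right_mono) auto
          then show "\<bar>rademacher J i / m * f (x i)\<bar> \<le> (K + b (x i)) / m"
            by (simp add: rademacher_def abs_mult)
        qed
        also have "\<dots> = K + r x"
          using m by (simp add: r_def sum.distrib add_divide_distrib flip: sum_divide_distrib)
        finally show "\<bar>\<Sum>i<m. rademacher J i / m * f (x i)\<bar> \<le> K + r x" .
      qed
      then have "W x \<le> (\<Sum>J\<in>Pow {..<m}. ennreal (K + r x))"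
        unfolding elim(2)[symmetric] by (intro sum_mono)
      also have "\<dots> = ennreal (2 ^ m * (K + r x))"
        using pos r_nonneg[of x] by (subst sum_ennreal) (auto simp: card_Pow)
      also have "\<dots> \<le> ennreal (2 ^ m * (c + r x) + 2 ^ m * K)"
        using c by (intro ennreal_leI) (simp add: algebra_simps)
      also have "\<dots> = ennreal (2 ^ m * (c + r x)) + ennreal (2 ^ m * K)"
        using c pos r_nonneg[of x] by (intro ennreal_plus) auto
      finally show ?thesis using True by simp
    qed (use elim in \<open>auto simp: C_def not_less\<close>)
  qed
  \<comment> \<open>The left side of \<open>symmetrization\<close> is the same for every
    \<open>J\<close>, so it may be summed over all \<open>2 ^ m\<close> sign vectors.\<close>
  have "2 ^ m * (\<integral>\<^sup>+x. ?T x \<partial>S) = (\<Sum>J\<in>Pow {..<m}. (\<integral>\<^sup>+x. ?T x \<partial>S))"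
    by (simp add: card_Pow)
  also have "\<dots> \<le> (\<Sum>J\<in>Pow {..<m}. 2 * (\<integral>\<^sup>+x. ?A J x \<partial>S))"
    by (intro sum_mono symmetrization F m)
  also have "\<dots> = (\<Sum>J\<in>Pow {..<m}. 2 * (\<integral>\<^sup>+x. A' J x \<partial>S))"
    using A'_eq by (intro sum.cong refl arg_cong2[where f="(*)"] nn_integral_cong_AE)
  also have "\<dots> = 2 * (\<integral>\<^sup>+x. W x \<partial>S)"
    unfolding W_def by (simp add: nn_integral_sum sum_distrib_left)
  also have "(\<integral>\<^sup>+x. W x \<partial>S) \<le> (\<integral>\<^sup>+x. ennreal (2 ^ m * (c + r x)) + ennreal (2 ^ m * K) * indicator C x \<partial>S)"
    by (rule nn_integral_mono_AE[OF W_le])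
  also have "\<dots> = (\<integral>\<^sup>+x. ennreal (2 ^ m * (c + r x)) \<partial>S) + ennreal (2 ^ m * K) * emeasure S C"
    using C by (simp add: nn_integral_add nn_integral_cmult_indicator)
  also have "(\<integral>\<^sup>+x. ennreal (2 ^ m * (c + r x)) \<partial>S) = ennreal (2 ^ m * (c + (\<integral>y. b y \<partial>M)))"
  proof -
    have "(\<integral>\<^sup>+x. ennreal (2 ^ m * (c + r x)) \<partial>S) = ennreal (\<integral>x. 2 ^ m * (c + r x) \<partial>S)"
      using r_int r_nonneg c by (intro nn_integral_eq_integral) auto
    also have "(\<integral>x. 2 ^ m * (c + r x) \<partial>S) = 2 ^ m * (c + (\<integral>x. r x \<partial>S))"
      using r_int P.prob_space by simp
    finally show ?thesis by (simp add: r_eq)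
  qed
  also have "ennreal (2 ^ m * K) * emeasure S C \<le> ennreal (2 ^ m * K) * ennreal p"
    by (intro mult_left_mono) (use \<open>emeasure S C \<le> ennreal p\<close> in auto)
  also have "2 * (ennreal (2 ^ m * (c + (\<integral>y. b y \<partial>M))) + ennreal (2 ^ m * K) * ennreal p)
      = 2 ^ m * ennreal (2 * (c + (\<integral>y. b y \<partial>M) + K * p))"
  proof -
    have I: "0 \<le> (\<integral>y. b y \<partial>M)" by (intro integral_nonneg_AE) (auto simp: b_def B(2))
    have two: "ennreal (2 ^ m) = 2 ^ m" by (simp flip: ennreal_power)
    have "ennreal (2 ^ m * (c + (\<integral>y. b y \<partial>M))) + ennreal (2 ^ m * K) * ennreal p
        = ennreal (2 ^ m * (c + (\<integral>y. b y \<partial>M) + K * p))"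
      using c I pos by (simp flip: ennreal_mult ennreal_plus add: algebra_simps)
    then have "2 * (ennreal (2 ^ m * (c + (\<integral>y. b y \<partial>M))) + ennreal (2 ^ m * K) * ennreal p)
        = ennreal (2 * (2 ^ m * (c + (\<integral>y. b y \<partial>M) + K * p)))"
      using c I pos by (simp add: ennreal_mult[of 2] del: ennreal_plus)
    also have "\<dots> = ennreal (2 ^ m) * ennreal (2 * (c + (\<integral>y. b y \<partial>M) + K * p))"
      using c I pos by (subst ennreal_mult[symmetric]) (auto simp: mult_ac)
    finally show ?thesis unfolding two .
  qed
  finally have "2 ^ m * (\<integral>\<^sup>+x. ?T x \<partial>S) \<le> 2 ^ m * ennreal (2 * (c + (\<integral>y. b y \<partial>M) + K * p))"
    by (simp add: mult_left_mono add_mono)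
  then show ?thesis
    unfolding c_def b_def by (subst (asm) ennreal_mult_le_mult_iff) (auto simp: power_eq_top_ennreal)
qed

end

section \<open>The uniform law of large numbers\<close>

lemma tail_integral_tendsto_zero:
  fixes B :: "'a \<Rightarrow> real"
  assumes B: "integrable M B"
  shows "(\<lambda>k. \<integral>y. B y * indicator {y. real k < B y} y \<partial>M) \<longlonglongrightarrow> 0"
proof -
  have [measurable]: "B \<in> borel_measurable M" using B by simp
  have "(\<lambda>k. \<integral>y. B y * indicator {y. real k < B y} y \<partial>M) \<longlonglongrightarrow> (\<integral>y. 0 \<partial>M)"
  proof (rule integral_dominated_convergence[where w="\<lambda>y. \<bar>B y\<bar>"])
    show "AE y in M. (\<lambda>k. B y * indicator {y. real k < B y} y) \<longlonglongrightarrow> 0"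
    proof (rule AE_I2)
      fix y
      obtain k where "B y \<le> real k" using real_arch_simple by blast
      then show "(\<lambda>k. B y * indicator {y. real k < B y} y) \<longlonglongrightarrow> 0"
        by (intro tendsto_eventually eventually_sequentiallyI[of k]) (auto simp: indicator_def)
    qed
  qed (use B in \<open>auto simp: indicator_def\<close>)
  then show ?thesis by simp
qed

context sequence_space
begin

lemma ghost_mean_small:
  assumes F: "sup_measurable_class M F" "F \<noteq> {}"
    and B: "integrable M B" "\<And>y. 0 \<le> B y" "AE y in M. \<forall>f\<in>F. \<bar>f y\<bar> \<le> B y"
    and inner: "\<And>\<delta> \<epsilon>. 0 < \<delta> \<Longrightarrow> 0 < \<epsilon> \<Longrightarrow> \<exists>p. p \<longlonglongrightarrow> 0 \<and> (\<forall>m. 0 \<le> p m) \<and>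
        (\<forall>m. \<forall>C\<in>sets S. C \<subseteq> {x. \<not> metric_entropy \<delta> F (empirical m x) / ereal (real m) \<le> ereal \<epsilon>}
          \<longrightarrow> emeasure S C \<le> ennreal (p m))"
    and \<theta>: "0 < \<theta>"
  obtains m where "0 < m" "(\<integral>\<^sup>+x. lin_sup F (ghost m) (m + m) x \<partial>S) \<le> ennreal \<theta>"
proof -
  \<comment> \<open>The five terms of \<open>ghost_mean_bound\<close> will be at most
    \<open>t\<close>, \<open>2 * t\<close>, \<open>t\<close>, \<open>t\<close> and \<open>t\<close>;
    their sum is doubled there.\<close>
  define t where "t = \<theta> / 12"
  have t: "0 < t" using \<theta> by (simp add: t_def)
  obtain K :: nat where K: "(\<integral>y. B y * indicator {y. real K < B y} y \<partial>M) < t"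
    using order_tendstoD(2)[OF tail_integral_tendsto_zero[OF B(1)] t] by (auto simp: eventually_sequentially)
  \<comment> \<open>The tail of \<open>B\<close> fixes \<open>K\<close>; then \<open>\<eta>\<close>
    absorbs \<open>K\<^sup>2\<close>; then the entropy level \<open>\<eta> * t\<close> survives the
    division by \<eta>; \<open>m\<close> comes last. The added 1 keeps the denominator positive for
    \<open>K = 0\<close>.\<close>
  define \<eta> where "\<eta> = t / ((real K)\<^sup>2 + 1)"
  have K1: "0 < (real K)\<^sup>2 + 1" by (simp add: add_nonneg_pos)
  have \<eta>: "0 < \<eta>" using t K1 by (simp add: \<eta>_def)
  have \<eta>K: "\<eta> * (real K)\<^sup>2 / 2 \<le> t"
  proof -
    have "\<eta> * (real K)\<^sup>2 \<le> \<eta> * ((real K)\<^sup>2 + 1)" using \<eta> by simp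
    also have "\<dots> = t" using K1 by (simp add: \<eta>_def)
    finally show ?thesis using t by simp
  qed
  obtain p where p: "p \<longlonglongrightarrow> 0" "\<And>m. 0 \<le> p m"
    "\<And>m C. C \<in> sets S \<Longrightarrow> C \<subseteq> {x. \<not> metric_entropy t F (empirical m x) / ereal (real m) \<le> ereal (\<eta> * t)}
          \<Longrightarrow> emeasure S C \<le> ennreal (p m)"
    using inner[OF t, of "\<eta> * t"] \<eta> t by (auto 0 3)
  have "(\<lambda>m. ln 2 / real m) \<longlonglongrightarrow> 0" by (rule lim_const_over_n)
  moreover have "(\<lambda>m. K * p m) \<longlonglongrightarrow> 0" using tendsto_mult_left[OF p(1), of K] by simp
  ultimately have "eventually (\<lambda>m. 0 < m \<and> ln 2 / real m < \<eta> * t \<and> K * p m < t) sequentially"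
    using \<eta> t by (intro eventually_conj eventually_gt_at_top order_tendstoD(2)[where y=0]) auto
  then obtain m where m: "0 < m" "ln 2 / real m < \<eta> * t" "K * p m < t"
    by (auto simp: eventually_sequentially)
  have "(\<integral>\<^sup>+x. lin_sup F (ghost m) (m + m) x \<partial>S)
    \<le> ennreal (2 * (t + (ln 2 / m + \<eta> * t) / \<eta> + \<eta> * (real K)\<^sup>2 / 2
         + (\<integral>y. B y * indicator {y. real K < B y} y \<partial>M) + K * p m))"
    by (rule ghost_mean_bound[OF F m(1) B t \<eta>]) (use \<eta> t p in auto)
  also have "\<dots> \<le> ennreal \<theta>"
  proof (rule ennreal_leI)
    have "(ln 2 / m + \<eta> * t) / \<eta> \<le> (2 * \<eta> * t) / \<eta>"
      using m(2) \<eta> by (intro divide_right_mono) auto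
    then have "(ln 2 / m + \<eta> * t) / \<eta> \<le> 2 * t" using \<eta> by simp
    moreover have "2 * (t + a + b + c + d) \<le> \<theta>" if "a \<le> 2 * t" "b \<le> t" "c \<le> t" "d \<le> t" for a b c d
      using that by (simp add: t_def)
    ultimately show "2 * (t + (ln 2 / m + \<eta> * t) / \<eta> + \<eta> * (real K)\<^sup>2 / 2
         + (\<integral>y. B y * indicator {y. real K < B y} y \<partial>M) + K * p m) \<le> \<theta>"
      using m(3) K \<eta>K less_imp_le by blast
  qed
  finally show ?thesis using that m(1) by blast
qed

text \<open>The deviation \<open>n * sup \<bar>R\<^sub>n f - R f\<bar>\<close> is subadditive along the sample, so that the ergodic
  theorem for blocks of length \<open>m\<close> upgrades a bound on the mean for one \<open>m\<close> to an almost sure one.\<close>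

lemma limsup_deviation_le:
  fixes F :: "('a \<Rightarrow> real) set"
  assumes F: "sup_measurable_class M F" and meas: "\<And>f. f \<in> F \<Longrightarrow> f \<in> borel_measurable M"
    and B: "integrable M B" "\<And>y. 0 \<le> B y" "AE y in M. \<forall>f\<in>F. \<bar>f y\<bar> \<le> B y"
    and m: "0 < m" and \<theta>: "0 \<le> \<theta>" "(\<integral>\<^sup>+x. lin_sup F (ghost m) (m + m) x \<partial>S) \<le> ennreal \<theta>"
    and \<epsilon>: "0 < \<epsilon>"
  shows "AE x in S. eventually (\<lambda>n. \<forall>f\<in>F. \<bar>(\<Sum>i<n. f (x i)) / n - (\<integral>y. f y \<partial>M)\<bar> \<le> \<theta> + \<epsilon>) sequentially"
proof -
  have int: "integrable M f" if "f \<in> F" for f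
    by (rule Bochner_Integration.integrable_bound[OF B(1) meas[OF that]]) (use B(3) that B(2) in auto)
  have IB: "\<bar>\<integral>y. f y \<partial>M\<bar> \<le> (\<integral>y. B y \<partial>M)" if "f \<in> F" for f
  proof -
    have "\<bar>\<integral>y. f y \<partial>M\<bar> \<le> (\<integral>y. \<bar>f y\<bar> \<partial>M)" using integral_norm_bound[of M f] by simp
    also have "\<dots> \<le> (\<integral>y. B y \<partial>M)"
      using B(3) int[OF that] B(1) that by (intro integral_mono_AE) auto
    finally show ?thesis .
  qed
  obtain u where u[measurable]: "u \<in> borel_measurable S"
    and u_dev: "AE x in S. \<forall>f\<in>F. ennreal \<bar>(\<Sum>i<m. f (x i)) / m - (\<integral>y. f y \<partial>M)\<bar> \<le> u x"
    and u_int: "(\<integral>\<^sup>+x. u x \<partial>S) = (\<integral>\<^sup>+x. lin_sup F (ghost m) (m + m) x \<partial>S)"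
    using ghost_majorant[OF F int m] by blast
  define v where "v x = enn2real (u x)" for x
  have v_nonneg: "0 \<le> v x" for x by (simp add: v_def)
  have [measurable]: "v \<in> borel_measurable S" unfolding v_def[abs_def] by measurable
  have u_fin: "(\<integral>\<^sup>+x. u x \<partial>S) < \<infinity>" using \<theta>(2) u_int by (auto simp: le_less_trans)
  then have fin: "AE x in S. u x \<noteq> \<infinity>" by (intro nn_integral_PInf_AE) auto
  have uv: "AE x in S. u x = ennreal (v x)" using fin by eventually_elim (simp add: v_def less_top)
  have nv: "(\<integral>\<^sup>+x. ennreal (v x) \<partial>S) = (\<integral>\<^sup>+x. u x \<partial>S)"
    using uv by (intro nn_integral_cong_AE) auto
  have v_int: "integrable S v"
    using u_fin nv by (intro integrableI_nonneg) (auto simp: v_def)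
  have v_le: "(\<integral>x. v x \<partial>S) \<le> \<theta>"
  proof -
    have "ennreal (\<integral>x. v x \<partial>S) = (\<integral>\<^sup>+x. ennreal (v x) \<partial>S)"
      using v_int v_nonneg by (intro nn_integral_eq_integral[symmetric]) auto
    then have "ennreal (\<integral>x. v x \<partial>S) \<le> ennreal \<theta>" using \<theta>(2) nv u_int by simp
    then show ?thesis using ennreal_le_iff[OF \<theta>(1)] by blast
  qed
  have v_dev: "AE x in S. \<forall>f\<in>F. \<bar>(\<Sum>i<m. f (x i)) / m - (\<integral>y. f y \<partial>M)\<bar> \<le> v x"
    using u_dev uv
  proof eventually_elim
    case (elim x)
    then show ?case using v_nonneg[of x] by (simp add: ennreal_le_iff)
  qed
  \<comment> \<open>Bounds the contribution of an incomplete last block, which has fewer than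
    \<open>m\<close> summands.\<close>
  define V where "V x = (\<Sum>i<m. B (x i) + (\<integral>y. B y \<partial>M))" for x
  have V_int: "integrable S V"
    unfolding V_def using integral_component[OF B(1)] by auto
  have B_all: "AE x in S. \<forall>i. \<forall>f\<in>F. \<bar>f (x i)\<bar> \<le> B (x i)"
    unfolding AE_all_countable using AE_component[OF _ B(3)] by auto
  have v_dev_all: "AE x in S. \<forall>j. \<forall>f\<in>F. \<bar>(\<Sum>i<m. f (seq_shift (j * m) x i)) / m - (\<integral>y. f y \<partial>M)\<bar> \<le> v (seq_shift (j * m) x)"
    unfolding AE_all_countable using AE_shift[OF v_dev] by auto
  from ergodic_average[OF v_int m] ergodic_average[OF V_int m] B_all v_dev_all
  show ?thesis
  proof eventually_elim
    case (elim x)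
    let ?v = "\<lambda>k. (\<Sum>j<k. v (seq_shift (j * m) x)) / real k" and ?V = "\<lambda>k. (\<Sum>j<k. V (seq_shift (j * m) x)) / real k"
    \<comment> \<open>By \<open>last\<close> below, the bracket is the contribution of the last
      block divided by \<open>k\<close>. It tends to 0 as the difference of two quantities with the
      same limit.\<close>
    have "(\<lambda>k. ?V (Suc k) * (real (Suc k) / real k) - ?V k) \<longlonglongrightarrow> (\<integral>x. V x \<partial>S) * 1 - (\<integral>x. V x \<partial>S)"
      using elim(2) by (intro tendsto_diff tendsto_mult LIMSEQ_Suc_n_over_n LIMSEQ_Suc[of ?V])
    then have "(\<lambda>k. ?v k + (?V (Suc k) * (real (Suc k) / real k) - ?V k)) \<longlonglongrightarrow> (\<integral>x. v x \<partial>S) + 0"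
      using elim(1) by (intro tendsto_add) auto
    then have ev: "eventually (\<lambda>k. ?v k + (?V (Suc k) * (real (Suc k) / real k) - ?V k) < \<theta> + \<epsilon>) sequentially"
      by (rule order_tendstoD) (use v_le \<epsilon> in auto)
    have last: "?V (Suc k) * (real (Suc k) / real k) - ?V k = V (seq_shift (k * m) x) / real k" if "0 < k" for k
    proof -
      have "a / real (Suc k) * (real (Suc k) / real k) = a / real k" for a by simp
      then have "?V (Suc k) * (real (Suc k) / real k) = (\<Sum>j<Suc k. V (seq_shift (j * m) x)) / real k" .
      then show ?thesis by (simp only: sum.lessThan_Suc add_divide_distrib add_diff_cancel_left')
    qed
    have "eventually (\<lambda>k. 0 < k \<and> ?v k + V (seq_shift (k * m) x) / real k < \<theta> + \<epsilon>) sequentially"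
      using ev eventually_gt_at_top[of 0]
    proof eventually_elim
      case (elim k)
      then show ?case unfolding last[OF elim(2)] by blast
    qed
    then have "eventually (\<lambda>n. 0 < n div m \<and> ?v (n div m) + V (seq_shift ((n div m) * m) x) / real (n div m) < \<theta> + \<epsilon>) sequentially"
      by (rule eventually_compose_filterlim[OF _ filterlim_at_top_div_const_nat[OF m]])
    then show ?case
    proof eventually_elim
      case (elim n)
      define k where "k = n div m"
      define r where "r = n mod m"
      have n: "n = k * m + r" and r: "r < m" and k: "0 < k"
        using m elim by (auto simp: k_def r_def)
      show ?case
      proof
        fix f assume f: "f \<in> F"
        let ?I = "\<integral>y. f y \<partial>M"
        have dev1: "\<bar>f (x i) - ?I\<bar> \<le> B (x i) + (\<integral>y. B y \<partial>M)" for i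
        proof -
          have "\<bar>f (x i)\<bar> \<le> B (x i)" using \<open>\<forall>i. \<forall>f\<in>F. \<bar>f (x i)\<bar> \<le> B (x i)\<close> f by blast
          with IB[OF f] show ?thesis by linarith
        qed
        have block: "\<bar>\<Sum>i<m. f (x (i + j * m)) - ?I\<bar> \<le> m * v (seq_shift (j * m) x)" for j
        proof -
          have "\<bar>(\<Sum>i<m. f (x (i + j * m))) / m - ?I\<bar> \<le> v (seq_shift (j * m) x)"
            using \<open>\<forall>j. \<forall>f\<in>F. \<bar>(\<Sum>i<m. f (seq_shift (j * m) x i)) / m - (\<integral>y. f y \<partial>M)\<bar> \<le> v (seq_shift (j * m) x)\<close> f
            by (auto simp: seq_shift_def)
          then have "m * \<bar>(\<Sum>i<m. f (x (i + j * m))) / m - ?I\<bar> \<le> m * v (seq_shift (j * m) x)"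
            by (rule mult_left_mono) simp
          moreover have "(\<Sum>i<m. f (x (i + j * m)) - ?I) = m * ((\<Sum>i<m. f (x (i + j * m))) / m - ?I)"
            using m by (simp add: sum_subtractf right_diff_distrib)
          ultimately show ?thesis by (simp add: abs_mult)
        qed
        have "\<bar>\<Sum>i<r. f (x (i + k * m)) - ?I\<bar> \<le> (\<Sum>i<r. \<bar>f (x (i + k * m)) - ?I\<bar>)" by (rule sum_abs)
        also have "\<dots> \<le> (\<Sum>i<r. B (x (i + k * m)) + (\<integral>y. B y \<partial>M))" by (intro sum_mono dev1)
        also have "\<dots> \<le> (\<Sum>i<m. B (x (i + k * m)) + (\<integral>y. B y \<partial>M))"
          using r by (intro sum_mono2) (auto intro!: add_nonneg_nonneg B integral_nonneg_AE)
        finally have rest: "\<bar>\<Sum>i<r. f (x (i + k * m)) - ?I\<bar> \<le> V (seq_shift (k * m) x)"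
          by (simp add: V_def seq_shift_def)
        have "\<bar>\<Sum>i<n. f (x i) - ?I\<bar> \<le> (\<Sum>j<k. m * v (seq_shift (j * m) x)) + V (seq_shift (k * m) x)"
          unfolding n sum_lessThan_blocks
          by (rule order_trans[OF abs_triangle_ineq], rule add_mono[OF order_trans[OF sum_abs] rest])
             (intro sum_mono block)
        then have sum_le: "\<bar>\<Sum>i<n. f (x i) - ?I\<bar> \<le> m * (\<Sum>j<k. v (seq_shift (j * m) x)) + V (seq_shift (k * m) x)"
          by (simp add: sum_distrib_left)
        have "k \<le> k * m" using m by simp
        then have nkm: "k * m \<le> n" and nk: "k \<le> n" and npos: "0 < n" using n k by linarith+
        from nk nkm have nk: "real k \<le> real n" and nkm: "real k * real m \<le> real n"
          by (simp_all flip: of_nat_mult)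
        have vs: "0 \<le> (\<Sum>j<k. v (seq_shift (j * m) x))" by (intro sum_nonneg) (simp add: v_def)
        have Vs: "0 \<le> V (seq_shift (k * m) x)"
          unfolding V_def by (intro sum_nonneg add_nonneg_nonneg B integral_nonneg_AE) (auto simp: B)
        have "(\<Sum>i<n. f (x i)) / n - ?I = (\<Sum>i<n. f (x i) - ?I) / n"
          using npos by (simp add: sum_subtractf diff_divide_distrib)
        then have "\<bar>(\<Sum>i<n. f (x i)) / n - ?I\<bar> = \<bar>\<Sum>i<n. f (x i) - ?I\<bar> / n" by simp
        also have "\<dots> \<le> (m * (\<Sum>j<k. v (seq_shift (j * m) x)) + V (seq_shift (k * m) x)) / n"
          using sum_le by (intro divide_right_mono) auto
        also have "\<dots> \<le> m * (\<Sum>j<k. v (seq_shift (j * m) x)) / (real k * real m) + V (seq_shift (k * m) x) / k"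
          unfolding add_divide_distrib using vs Vs nk nkm k m by (intro add_mono divide_left_mono) auto
        also have "\<dots> = ?v k + V (seq_shift (k * m) x) / k" using m by simp
        also have "\<dots> < \<theta> + \<epsilon>" using elim by (simp add: k_def)
        finally show "\<bar>(\<Sum>i<n. f (x i)) / n - ?I\<bar> \<le> \<theta> + \<epsilon>" by simp
      qed
    qed
  qed
qed

lemma uniform_law_sequence_space:
  fixes F :: "('a \<Rightarrow> real) set"
  assumes F: "sup_measurable_class M F" "F \<noteq> {}" and meas: "\<And>f. f \<in> F \<Longrightarrow> f \<in> borel_measurable M"
    and B: "integrable M B" "\<And>y. 0 \<le> B y" "AE y in M. \<forall>f\<in>F. \<bar>f y\<bar> \<le> B y"
    and inner: "\<And>\<delta> \<epsilon>. 0 < \<delta> \<Longrightarrow> 0 < \<epsilon> \<Longrightarrow> \<exists>p. p \<longlonglongrightarrow> 0 \<and> (\<forall>m. 0 \<le> p m) \<and>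
        (\<forall>m. \<forall>C\<in>sets S. C \<subseteq> {x. \<not> metric_entropy \<delta> F (empirical m x) / ereal (real m) \<le> ereal \<epsilon>}
          \<longrightarrow> emeasure S C \<le> ennreal (p m))"
  shows "AE x in S. \<forall>\<epsilon>>0. eventually (\<lambda>n. \<forall>f\<in>F. \<bar>(\<Sum>i<n. f (x i)) / n - (\<integral>y. f y \<partial>M)\<bar> \<le> \<epsilon>) sequentially"
proof -
  \<comment> \<open>Both \<theta> and \<epsilon> of \<open>limsup_deviation_le\<close> run through
    the reciprocals of positive integers, so only countably many null sets are discarded.\<close>
  have "AE x in S. \<forall>q. eventually (\<lambda>n. \<forall>f\<in>F. \<bar>(\<Sum>i<n. f (x i)) / n - (\<integral>y. f y \<partial>M)\<bar> \<le> 1 / real (Suc q) + 1 / real (Suc q)) sequentially"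
    unfolding AE_all_countable
  proof
    fix q
    obtain m where "0 < m" "(\<integral>\<^sup>+x. lin_sup F (ghost m) (m + m) x \<partial>S) \<le> ennreal (1 / real (Suc q))"
      by (rule ghost_mean_small[OF F B inner, of "1 / real (Suc q)"]) auto
    then show "AE x in S. eventually (\<lambda>n. \<forall>f\<in>F. \<bar>(\<Sum>i<n. f (x i)) / n - (\<integral>y. f y \<partial>M)\<bar> \<le> 1 / real (Suc q) + 1 / real (Suc q)) sequentially"
      by (intro limsup_deviation_le[OF F(1) meas B]) auto
  qed
  then show ?thesis
  proof eventually_elim
    case (elim x)
    show ?case
    proof (intro allI impI)
      fix \<epsilon> :: real assume "0 < \<epsilon>"
      then obtain q where "1 / real (Suc q) < \<epsilon> / 2"
        using reals_Archimedean[of "\<epsilon> / 2"] by (auto simp: inverse_eq_divide)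
      then have q: "1 / real (Suc q) + 1 / real (Suc q) \<le> \<epsilon>" by linarith
      show "eventually (\<lambda>n. \<forall>f\<in>F. \<bar>(\<Sum>i<n. f (x i)) / n - (\<integral>y. f y \<partial>M)\<bar> \<le> \<epsilon>) sequentially"
        using elim[rule_format, of q] by eventually_elim (use q in \<open>auto intro: order_trans\<close>)
    qed
  qed
qed

end

section \<open>Samples on an arbitrary probability space\<close>

locale iid_sample = prob_space \<Omega> for \<Omega> :: "'w measure" +
  fixes R :: "'a measure" and X :: "nat \<Rightarrow> 'w \<Rightarrow> 'a"
  assumes indep: "indep_vars (\<lambda>_. R) X UNIV"
    and law: "\<And>i. distr \<Omega> R (X i) = R"
begin

lemma measurable_sample [measurable]: "X i \<in> measurable \<Omega> R"
  using indep by (auto simp: indep_vars_def)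

sublocale R: prob_space R
  using prob_space_distr[OF measurable_sample[of 0]] by (simp add: law)

sublocale seq: sequence_space R
  by unfold_locales

lemma measurable_path: "(\<lambda>\<omega> i. X i \<omega>) \<in> measurable \<Omega> (PiM UNIV (\<lambda>_. R))"
  by (rule measurable_PiM_single') (auto simp: space_PiM intro: measurable_space[OF measurable_sample])

lemma distr_path: "distr \<Omega> (PiM UNIV (\<lambda>_. R)) (\<lambda>\<omega> i. X i \<omega>) = PiM UNIV (\<lambda>_. R)"
  using indep by (subst (asm) indep_vars_iff_distr_eq_PiM) (auto simp: law restrict_def)

lemma AE_path: "AE x in PiM UNIV (\<lambda>_. R). P x \<Longrightarrow> AE \<omega> in \<Omega>. P (\<lambda>i. X i \<omega>)"
  using AE_distrD[OF measurable_path, of P] by (simp only: distr_path)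

lemma AE_sample: "AE y in R. P y \<Longrightarrow> AE \<omega> in \<Omega>. \<forall>i. P (X i \<omega>)"
  unfolding AE_all_countable using AE_distrD[OF measurable_sample, of P] by (simp only: law) blast

lemma iid_strong_law:
  fixes f :: "'a \<Rightarrow> real"
  assumes "integrable R f"
  shows "AE \<omega> in \<Omega>. (\<lambda>n. (\<Sum>i<n. f (X i \<omega>)) / real n) \<longlonglongrightarrow> (\<integral>y. f y \<partial>R)"
  by (rule AE_path[OF seq.strong_law[OF assms]])

theorem uniform_law_of_large_numbers:
  fixes F :: "('a \<Rightarrow> real) set"
  assumes F: "sup_measurable_class R F" "F \<noteq> {}" and meas: "\<And>f. f \<in> F \<Longrightarrow> f \<in> borel_measurable R"
    and B: "integrable R B" "\<And>y. 0 \<le> B y" "AE y in R. \<forall>f\<in>F. \<bar>f y\<bar> \<le> B y"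
    and ent: "\<And>\<delta>. 0 < \<delta> \<Longrightarrow> tendsto_zero_in_prob \<Omega>
         (\<lambda>n \<omega>. metric_entropy \<delta> F (empirical n (\<lambda>i. X i \<omega>)) / ereal (real n))"
  shows "AE \<omega> in \<Omega>. \<forall>\<epsilon>>0. eventually (\<lambda>n. \<forall>f\<in>F. \<bar>(\<Sum>i<n. f (X i \<omega>)) / n - (\<integral>y. f y \<partial>R)\<bar> \<le> \<epsilon>) sequentially"
proof (rule AE_path, rule seq.uniform_law_sequence_space[OF F meas B])
  fix \<delta> \<epsilon> :: real assume \<delta>: "0 < \<delta>" and \<epsilon>: "0 < \<epsilon>"
  let ?Z = "\<lambda>n \<omega>. metric_entropy \<delta> F (empirical n (\<lambda>i. X i \<omega>)) / ereal (real n)"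
  define p where "p n = outer_measure_of \<Omega> {\<omega>\<in>space \<Omega>. \<bar>?Z n \<omega>\<bar> > ereal \<epsilon>}" for n
  have p_fin: "p n \<noteq> \<infinity>" for n
  proof -
    have "p n \<le> outer_measure_of \<Omega> (space \<Omega>)" unfolding p_def by (rule outer_measure_of_mono) auto
    also have "\<dots> = 1" by (simp add: emeasure_space_1)
    finally show ?thesis by (auto simp: top_unique)
  qed
  have "p \<longlonglongrightarrow> 0" using ent[OF \<delta>] \<epsilon> unfolding tendsto_zero_in_prob_def p_def by auto
  then have "(\<lambda>n. enn2real (p n)) \<longlonglongrightarrow> 0"
    using tendsto_enn2real[of p 0] by simp
  \<comment> \<open>A measurable set of paths pulls back to an event of the same probability, and
    this event lies in the set whose outer probability is \<open>p n\<close>.\<close>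
  moreover have "emeasure seq.S C \<le> ennreal (enn2real (p n))"
    if C: "C \<in> sets seq.S" and sub: "C \<subseteq> {x. \<not> metric_entropy \<delta> F (empirical n x) / ereal (real n) \<le> ereal \<epsilon>}" for n C
  proof -
    have "emeasure seq.S C = emeasure \<Omega> ((\<lambda>\<omega> i. X i \<omega>) -` C \<inter> space \<Omega>)"
      by (subst distr_path[symmetric]) (rule emeasure_distr[OF measurable_path C])
    also have "\<dots> = outer_measure_of \<Omega> ((\<lambda>\<omega> i. X i \<omega>) -` C \<inter> space \<Omega>)"
      by (rule outer_measure_of_eq[symmetric]) (rule measurable_sets[OF measurable_path C])
    also have "\<dots> \<le> p n"
      unfolding p_def
    proof (rule outer_measure_of_mono, safe)
      fix \<omega> assume "(\<lambda>i. X i \<omega>) \<in> C"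
      with sub have "ereal \<epsilon> < ?Z n \<omega>" by (auto simp: not_le)
      also have "?Z n \<omega> \<le> \<bar>?Z n \<omega>\<bar>" by (cases "?Z n \<omega>") auto
      finally show "ereal \<epsilon> < \<bar>?Z n \<omega>\<bar>" .
    qed
    also have "p n = ennreal (enn2real (p n))" using p_fin[of n] by (simp add: less_top)
    finally show ?thesis .
  qed
  ultimately show "\<exists>p. p \<longlonglongrightarrow> 0 \<and> (\<forall>m. 0 \<le> p m) \<and>
        (\<forall>m. \<forall>C\<in>sets seq.S. C \<subseteq> {x. \<not> metric_entropy \<delta> F (empirical m x) / ereal (real m) \<le> ereal \<epsilon>}
          \<longrightarrow> emeasure seq.S C \<le> ennreal (p m))"
    by (intro exI[of _ "\<lambda>n. enn2real (p n)"]) auto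
qed

end

section \<open>Envelopes and the empirical objective\<close>

text \<open>Lets the case of a single observation in \<open>sup_measurable_class\<close> speak about
  \<open>R\<close> itself. On a product over one index, reading the coordinate and rebuilding the
  sequence is the identity.\<close>

lemma distr_one_coordinate:
  assumes "prob_space R"
  shows "distr R (PiM {..<1::nat} (\<lambda>_. R)) (\<lambda>y. \<lambda>i\<in>{..<1}. y) = PiM {..<1} (\<lambda>_. R)" (is "distr R ?P ?T = ?P")
proof -
  have T[measurable]: "?T \<in> measurable R ?P" by measurable
  have "distr R ?P ?T = distr (distr ?P R (\<lambda>x. x 0)) ?P ?T"
    using assms by (subst distr_PiM_component) auto
  also have "\<dots> = distr ?P ?P (?T \<circ> (\<lambda>x. x 0))"
    by (rule distr_distr[OF T]) simp
  also have "\<dots> = distr ?P ?P (\<lambda>x. x)"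
    by (rule distr_cong) (auto simp: space_PiM PiE_iff extensional_def fun_eq_iff)
  also have "\<dots> = ?P" by simp
  finally show ?thesis .
qed

lemma class_sup_borel:
  assumes R: "prob_space R" and F: "sup_measurable_class R F"
  obtains D where "D \<in> borel_measurable R" "AE y in R. (SUP f\<in>F. ennreal \<bar>f y\<bar>) = D y"
proof -
  let ?P = "PiM {..<1::nat} (\<lambda>_. R)" and ?T = "\<lambda>y. \<lambda>i\<in>{..<1::nat}. y"
  have "lin_sup F (\<lambda>_. 1) 1 \<in> borel_measurable (completion ?P)"
    using F[unfolded sup_measurable_class_def, rule_format, of "\<lambda>_. 1" 1] unfolding lin_sup_def[abs_def] .
  from completion_ex_borel_measurable[OF this] obtain g
    where g[measurable]: "g \<in> borel_measurable ?P" and eq: "AE x in ?P. lin_sup F (\<lambda>_. 1) 1 x = g x" by auto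
  have T: "?T \<in> measurable R ?P" by measurable
  have "AE y in R. lin_sup F (\<lambda>_. 1) 1 (?T y) = g (?T y)"
    using AE_distrD[OF T, of "\<lambda>x. lin_sup F (\<lambda>_. 1) 1 x = g x"] eq
    by (simp only: distr_one_coordinate[OF R])
  moreover have "lin_sup F (\<lambda>_. 1) 1 (?T y) = (SUP f\<in>F. ennreal \<bar>f y\<bar>)" for y
    by (simp add: lin_sup_def)
  ultimately show ?thesis
    using that[of "\<lambda>y. g (?T y)"] measurable_compose[OF T g] by simp
qed

text \<open>The supremum agrees with a Borel function, and is finite, only outside a null set; hence
  the real bound is asserted almost everywhere, for all \<open>f\<close> at once.\<close>

lemma class_envelope:
  assumes R: "prob_space R" and F: "sup_measurable_class R F"
    and fin: "(\<integral>\<^sup>+y. (SUP f\<in>F. ennreal \<bar>f y\<bar>) \<partial>R) < \<infinity>"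
  obtains B :: "'a \<Rightarrow> real"
  where "integrable R B" "\<And>y. 0 \<le> B y" "AE y in R. \<forall>f\<in>F. \<bar>f y\<bar> \<le> B y"
proof -
  obtain D where D[measurable]: "D \<in> borel_measurable R"
    and eq: "AE y in R. (SUP f\<in>F. ennreal \<bar>f y\<bar>) = D y" by (rule class_sup_borel[OF R F])
  have "(\<integral>\<^sup>+y. (SUP f\<in>F. ennreal \<bar>f y\<bar>) \<partial>R) = (\<integral>\<^sup>+y. D y \<partial>R)"
    by (rule nn_integral_cong_AE[OF eq])
  with fin have finD: "(\<integral>\<^sup>+y. D y \<partial>R) < \<infinity>" by simp
  then have "AE y in R. D y \<noteq> \<infinity>" by (intro nn_integral_PInf_AE) auto
  then have eqB: "AE y in R. D y = ennreal (enn2real (D y))"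
    by eventually_elim (simp add: less_top)
  show ?thesis
  proof
    have "(\<integral>\<^sup>+y. ennreal (enn2real (D y)) \<partial>R) = (\<integral>\<^sup>+y. D y \<partial>R)"
      using eqB by (intro nn_integral_cong_AE) auto
    then show "integrable R (\<lambda>y. enn2real (D y))"
      using finD by (intro integrableI_nonneg) auto
    show "AE y in R. \<forall>f\<in>F. \<bar>f y\<bar> \<le> enn2real (D y)"
      using eq eqB
    proof eventually_elim
      case (elim y)
      show ?case
      proof
        fix f assume "f \<in> F"
        then have "ennreal \<bar>f y\<bar> \<le> (SUP f\<in>F. ennreal \<bar>f y\<bar>)" by (rule SUP_upper)
        also note elim(1)
        also note elim(2)
        finally have "ennreal \<bar>f y\<bar> \<le> ennreal (enn2real (D y))" .
        then show "\<bar>f y\<bar> \<le> enn2real (D y)" by (subst (asm) ennreal_le_iff) auto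
      qed
    qed
  qed simp
qed

text \<open>The envelope \<open>e\<close> need not be measurable, in which case its integral is a lower integral.\<close>

lemma nn_integral_finite_dominated:
  fixes H :: "'a \<Rightarrow> ennreal" and k :: "'a \<Rightarrow> real"
  assumes [measurable]: "H \<in> borel_measurable N" "k \<in> borel_measurable N"
    and le: "AE y in N. H y \<le> ennreal (k y) + e y"
    and e: "(\<integral>\<^sup>+y. e y \<partial>N) < \<infinity>" and k: "(\<integral>\<^sup>+y. ennreal (k y) \<partial>N) < \<infinity>"
  shows "(\<integral>\<^sup>+y. H y \<partial>N) < \<infinity>"
proof -
  have "(\<integral>\<^sup>+y. H y - ennreal (k y) \<partial>N) \<le> (\<integral>\<^sup>+y. e y \<partial>N)"
    using le by (intro nn_integral_mono_AE) (auto simp: ennreal_minus_le_iff)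
  then have fin: "(\<integral>\<^sup>+y. H y - ennreal (k y) \<partial>N) < \<infinity>" using e by (rule le_less_trans)
  have "(\<integral>\<^sup>+y. H y \<partial>N) \<le> (\<integral>\<^sup>+y. ennreal (k y) + (H y - ennreal (k y)) \<partial>N)"
  proof (rule nn_integral_mono)
    fix y
    show "H y \<le> ennreal (k y) + (H y - ennreal (k y))"
      by (cases "ennreal (k y) \<le> H y") (auto simp: add_diff_inverse_ennreal add_increasing2)
  qed
  also have "\<dots> = (\<integral>\<^sup>+y. ennreal (k y) \<partial>N) + (\<integral>\<^sup>+y. H y - ennreal (k y) \<partial>N)"
    by (rule nn_integral_add) auto
  also have "\<dots> < \<infinity>" using fin k by (auto simp: less_top)
  finally show ?thesis .
qed

section \<open>The empirical objective and its maximisers\<close>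

lemma nn_integral_empirical:
  "0 < n \<Longrightarrow> (\<integral>\<^sup>+y. f y \<partial>(empirical n x)) = (\<Sum>i<n. f (x i)) / of_nat n"
  by (simp add: empirical_def nn_integral_pmf_of_set lessThan_empty_iff)

lemma integral_empirical:
  "0 < n \<Longrightarrow> (\<integral>y. f y \<partial>(empirical n x)) = (\<Sum>i<n. f (x i)) / real n" for f :: "'a \<Rightarrow> real"
  by (simp add: empirical_def integral_pmf_of_set lessThan_empty_iff)

lemma ratio_objective_empirical:
  assumes n: "0 < n" and pos: "\<And>i. i < n \<Longrightarrow> 0 < g (x i)"
  shows "ratio_objective (empirical n x) (empirical n y) g
    = ereal ((\<Sum>i<n. ln (g (x i))) / n - (\<Sum>i<n. g (y i)) / n)"
proof -
  have part: "enn2ereal (\<integral>\<^sup>+z. e2ennreal (h z) \<partial>(empirical n x)) = ereal ((\<Sum>i<n. max 0 (a i)) / n)"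
    if "\<And>i. i < n \<Longrightarrow> h (x i) = ereal (a i)" for h :: "'a \<Rightarrow> ereal" and a :: "nat \<Rightarrow> real"
  proof -
    have "(\<Sum>i<n. e2ennreal (h (x i))) = (\<Sum>i<n. ennreal (max 0 (a i)))"
      by (rule sum.cong) (auto simp: that ennreal_max_0)
    also have "\<dots> = ennreal (\<Sum>i<n. max 0 (a i))" by (rule sum_ennreal) auto
    finally have "(\<integral>\<^sup>+z. e2ennreal (h z) \<partial>(empirical n x)) = ennreal ((\<Sum>i<n. max 0 (a i)) / n)"
      unfolding nn_integral_empirical[OF n] using n
      by (simp add: ennreal_of_nat_eq_real_of_nat divide_ennreal sum_nonneg)
    then show ?thesis by (simp add: enn2ereal_ennreal sum_nonneg)
  qed
  have "ext_integral (empirical n x) (\<lambda>z. ext_ln (g z))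
      = ereal ((\<Sum>i<n. max 0 (ln (g (x i)))) / n) - ereal ((\<Sum>i<n. max 0 (- ln (g (x i)))) / n)"
    unfolding ext_integral_def
    by (intro arg_cong2[where f="(-)"] part) (auto simp: ext_ln_def pos)
  also have "\<dots> = ereal ((\<Sum>i<n. max 0 (ln (g (x i))) - max 0 (- ln (g (x i)))) / n)"
    by (simp add: sum_subtractf diff_divide_distrib)
  also have "\<dots> = ereal ((\<Sum>i<n. ln (g (x i))) / n)"
    by (intro arg_cong[where f=ereal] arg_cong2[where f="(/)"] sum.cong) auto
  finally show ?thesis unfolding ratio_objective_def by (simp add: integral_empirical[OF n])
qed

text \<open>One infinite term makes the negative part infinite, while the positive part is a finite
  sum of finite terms, so \<open>\<infinity> - \<infinity>\<close> never arises. This excludes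
  maximisers that vanish at an observation of the first sample.\<close>

lemma ratio_objective_empirical_eq_MInf:
  assumes n: "0 < n" and i: "i < n" "g (x i) \<le> 0"
  shows "ratio_objective (empirical n x) (empirical n y) g = - \<infinity>"
proof -
  have top: "(\<Sum>j<n. e2ennreal (- ext_ln (g (x j)))) = \<top>"
    using i member_le_sum[of i "{..<n}" "\<lambda>j. e2ennreal (- ext_ln (g (x j)))"]
    by (simp add: ext_ln_def top_unique)
  have "(\<Sum>j<n. e2ennreal (ext_ln (g (x j)))) < \<top>"
    by (auto simp: ext_ln_def e2ennreal_neg)
  then have "(\<Sum>j<n. e2ennreal (ext_ln (g (x j)))) / of_nat n \<noteq> \<top>"
    using n by (force simp: ennreal_divide_eq_top_iff)
  then obtain r where r: "0 \<le> r" "(\<Sum>j<n. e2ennreal (ext_ln (g (x j)))) / of_nat n = ennreal r"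
    by (cases "(\<Sum>j<n. e2ennreal (ext_ln (g (x j)))) / of_nat n") auto
  have "(\<Sum>j<n. e2ennreal (- ext_ln (g (x j)))) / of_nat n = \<top>"
    unfolding top by (simp add: ennreal_top_divide)
  then have "ext_integral (empirical n x) (\<lambda>z. ext_ln (g z)) = - \<infinity>"
    unfolding ext_integral_def nn_integral_empirical[OF n] r(2) using r(1)
    by (simp only:) (simp add: enn2ereal_ennreal)
  then show ?thesis unfolding ratio_objective_def by simp
qed

text \<open>\<open>gs\<close> competes on behalf of \<open>g0\<close>: it belongs to the class and
  agrees with \<open>g0\<close> at every observation. Its objective is finite, so that of the
  maximiser is not minus infinity.\<close>

lemma argmax_optimality:
  assumes n: "0 < n"
    and max: "is_arg_max (ratio_objective (empirical n x) (empirical n y)) (\<lambda>g. g \<in> G) h"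
    and gs: "gs \<in> G" "\<And>i. gs (x i) = g0 (x i)" "\<And>i. gs (y i) = g0 (y i)" "\<And>i. 0 < g0 (x i)"
  shows "h \<in> G" "\<And>i. i < n \<Longrightarrow> 0 < h (x i)"
    "(\<Sum>i<n. ln (g0 (x i))) / n - (\<Sum>i<n. g0 (y i)) / n \<le> (\<Sum>i<n. ln (h (x i))) / n - (\<Sum>i<n. h (y i)) / n"
proof -
  let ?L = "ratio_objective (empirical n x) (empirical n y)"
  show "h \<in> G" using max by (auto simp: is_arg_max_def)
  have Ls: "?L gs = ereal ((\<Sum>i<n. ln (g0 (x i))) / n - (\<Sum>i<n. g0 (y i)) / n)"
    using ratio_objective_empirical[OF n, of gs x y] gs by simp
  have le: "?L gs \<le> ?L h" using max gs(1) by (auto simp: is_arg_max_def not_less)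
  show pos: "0 < h (x i)" if "i < n" for i
  proof (rule ccontr)
    assume "\<not> 0 < h (x i)"
    with ratio_objective_empirical_eq_MInf[OF n that, of h x y] have "?L h = - \<infinity>" by simp
    with le Ls show False by simp
  qed
  show "(\<Sum>i<n. ln (g0 (x i))) / n - (\<Sum>i<n. g0 (y i)) / n \<le> (\<Sum>i<n. ln (h (x i))) / n - (\<Sum>i<n. h (y i)) / n"
  proof -
    have "?L h = ereal ((\<Sum>i<n. ln (h (x i))) / n - (\<Sum>i<n. h (y i)) / n)"
      by (rule ratio_objective_empirical[OF n]) (rule pos)
    with le Ls show ?thesis by simp
  qed
qed

section \<open>Inequalities behind the Hellinger distance\<close>

lemma hellinger_power2: "(hellinger Q g0 g)\<^sup>2 = (1 / 2) * (\<integral>x. (sqrt (g0 x) - sqrt (g x))\<^sup>2 \<partial>Q)"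
  unfolding hellinger_def by (rule real_sqrt_pow2) (auto intro!: mult_nonneg_nonneg integral_nonneg_AE)

lemma hellinger_nonneg: "0 \<le> hellinger Q g0 g"
  unfolding hellinger_def by (rule real_sqrt_ge_zero) (auto intro!: mult_nonneg_nonneg integral_nonneg_AE)

lemma tendsto_zero_power2:
  fixes h :: "nat \<Rightarrow> real"
  assumes "\<And>n. 0 \<le> h n" and c: "0 < c" and ev: "\<And>\<epsilon>. 0 < \<epsilon> \<Longrightarrow> eventually (\<lambda>n. (h n)\<^sup>2 \<le> c * \<epsilon>) sequentially"
  shows "h \<longlonglongrightarrow> 0"
proof (rule tendstoI)
  fix e :: real assume e: "0 < e"
  have "eventually (\<lambda>n. (h n)\<^sup>2 \<le> c * (e\<^sup>2 / (2 * c))) sequentially" using e c by (intro ev) auto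
  then show "eventually (\<lambda>n. dist (h n) 0 < e) sequentially"
  proof eventually_elim
    case (elim n)
    have "c * (e\<^sup>2 / (2 * c)) = e\<^sup>2 / 2" "0 < e\<^sup>2" using e c by auto
    with elim have "(h n)\<^sup>2 < e\<^sup>2" by linarith
    then have "h n < e" using e by (auto dest: power2_less_imp_less)
    then show ?case using assms(1)[of n] by (simp add: dist_real_def)
  qed
qed

text \<open>With \<open>a = g0 x\<close> and \<open>b = g x\<close>, integration over
  \<open>Q\<close> turns the left side into twice the squared Hellinger distance, and the weight
  \<open>a\<close> turns the logarithm into an integral over \<open>P\<close>. In terms of square
  roots, \<open>ln (b / a)\<close> is \<open>2 * ln (v / u)\<close>, and the tangent bound for
  \<open>ln\<close> leaves exactly the square.\<close>

lemma sqrt_diff_power2_le_log: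
  fixes a b :: real
  assumes a: "0 < a" and b: "0 < b"
  shows "(sqrt a - sqrt b)\<^sup>2 \<le> (b - a) - a * ln (b / a)"
proof -
  define u v where "u = sqrt a" and "v = sqrt b"
  have u: "0 < u" "a = u\<^sup>2" and v: "0 < v" "b = v\<^sup>2" using a b by (auto simp: u_def v_def)
  have "ln (b / a) = 2 * ln (v / u)"
    using u v by (simp add: ln_realpow flip: power_divide)
  also have "\<dots> \<le> 2 * (v / u - 1)" using u v by (intro mult_left_mono ln_le_minus_one) auto
  finally have "a * ln (b / a) \<le> a * (2 * (v / u - 1))" using a by (intro mult_left_mono) auto
  also have "\<dots> = 2 * u * v - 2 * u\<^sup>2" using u by (simp add: field_simps power2_eq_square)
  finally show ?thesis unfolding u_def[symmetric] v_def[symmetric] using u v by (simp add: power2_diff)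
qed

text \<open>The constant \<open>16 = 4\<^sup>2\<close> comes from \<open>sqrt m \<le> sqrt a + sqrt b\<close> for the midpoint \<open>m\<close>.\<close>

lemma sqrt_diff_midpoint:
  fixes a b :: real
  assumes a: "0 \<le> a" and b: "0 \<le> b"
  shows "(sqrt a - sqrt b)\<^sup>2 \<le> 16 * (sqrt a - sqrt ((b + a) / 2))\<^sup>2"
proof -
  define u v w where "u = sqrt a" and "v = sqrt b" and "w = sqrt ((b + a) / 2)"
  have u: "0 \<le> u" "a = u\<^sup>2" and v: "0 \<le> v" "b = v\<^sup>2" and w: "0 \<le> w" "w\<^sup>2 = (v\<^sup>2 + u\<^sup>2) / 2"
    using a b by (auto simp: u_def v_def w_def)
  have "w\<^sup>2 \<le> (u + v)\<^sup>2" 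
  proof -
    have "(u + v)\<^sup>2 - w\<^sup>2 = (u\<^sup>2 + v\<^sup>2) / 2 + 2 * (u * v)"
      unfolding w(2) by (simp add: power2_sum field_simps)
    also have "0 \<le> \<dots>" using u v by simp
    finally show ?thesis by simp
  qed
  then have wle: "w \<le> u + v" using u v by (auto dest: power2_le_imp_le)
  \<comment> \<open>\<open>u\<^sup>2 - v\<^sup>2\<close> is twice
    \<open>u\<^sup>2 - w\<^sup>2\<close>; after factoring both,
    \<open>u + w \<le> 2 * (u + v)\<close> supplies the second factor 2.\<close>
  have "\<bar>u - v\<bar> * (u + v) = \<bar>u\<^sup>2 - v\<^sup>2\<bar>"
    using u v by (simp add: abs_mult power2_eq_square square_diff_square_factored mult.commute)
  also have "u\<^sup>2 - v\<^sup>2 = 2 * (u\<^sup>2 - w\<^sup>2)" using w by (simp add: field_simps)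
  also have "\<bar>2 * (u\<^sup>2 - w\<^sup>2)\<bar> = 2 * \<bar>u - w\<bar> * (u + w)"
    using u w by (simp add: abs_mult power2_eq_square square_diff_square_factored mult.commute)
  also have "\<dots> \<le> 2 * \<bar>u - w\<bar> * (2 * (u + v))" using wle u v by (intro mult_left_mono) auto
  finally have le: "\<bar>u - v\<bar> * (u + v) \<le> (4 * \<bar>u - w\<bar>) * (u + v)" by (simp add: algebra_simps)
  have "\<bar>u - v\<bar> \<le> 4 * \<bar>u - w\<bar>"
  proof (cases "u + v = 0")
    case True
    then have "u = 0" "v = 0" using u v by linarith+
    then show ?thesis by simp
  next
    case False
    then have "0 < u + v" using u v by linarith
    with le show ?thesis by (rule mult_right_le_imp_le)
  qed
  then have "\<bar>u - v\<bar>\<^sup>2 \<le> (4 * \<bar>u - w\<bar>)\<^sup>2" by (rule power_mono) simp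
  then show ?thesis by (simp add: power_mult_distrib u_def v_def w_def)
qed

text \<open>Concavity of \<open>ln\<close>, as the inequality of arithmetic and geometric means for
  \<open>b / a\<close> and 1. It hands the optimality of the estimator on to its midpoint with
  \<open>g0\<close>, at half strength.\<close>

lemma ln_half_sum_ge:
  fixes a b :: real
  assumes "0 < a" "0 < b"
  shows "ln (b / a) / 2 \<le> ln ((b + a) / (2 * a))"
proof -
  have "ln (b / a) / 2 = ln (sqrt (b / a))" using assms by (simp add: ln_sqrt)
  also have "sqrt (b / a) \<le> (b / a + 1) / 2"
    using assms arith_geo_mean_sqrt[of "b / a" 1] by simp
  then have "ln (sqrt (b / a)) \<le> ln ((b / a + 1) / 2)" using assms by (subst ln_le_cancel_iff) (auto simp: add_pos_pos)
  also have "(b / a + 1) / 2 = (b + a) / (2 * a)" using assms by (simp add: field_simps)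
  finally show ?thesis .
qed

section \<open>Consistency of maximisers\<close>

lemma sqrt_diff_power2_le_add: "0 \<le> a \<Longrightarrow> 0 \<le> b \<Longrightarrow> (sqrt a - sqrt b)\<^sup>2 \<le> a + b"
  by (simp add: power2_diff)

lemma class_integrable:
  assumes B: "integrable R B" "AE x in R. \<forall>f\<in>F. \<bar>f x\<bar> \<le> B x" and f: "f \<in> F" "f \<in> borel_measurable R"
  shows "integrable R (f :: 'a \<Rightarrow> real)"
  by (rule Bochner_Integration.integrable_bound[OF B(1) f(2)]) (use B(2) f(1) in \<open>auto elim!: eventually_mono\<close>)

text \<open>The reference measure is gone: \<open>P\<close> has density \<open>g0\<close> with
  respect to \<open>Q\<close>. \<open>g0_pos\<close> expresses the common support, so both measures
  have the same null sets.\<close>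

locale likelihood_ratio = Q: prob_space Q + P: prob_space P for P Q :: "'a measure" +
  fixes g0 :: "'a \<Rightarrow> real" and G :: "('a \<Rightarrow> real) set"
  assumes P_eq: "P = density Q (\<lambda>x. ennreal (g0 x))"
    and g0_meas [measurable]: "g0 \<in> borel_measurable Q"
    and g0_nonneg: "\<And>x. x \<in> space Q \<Longrightarrow> 0 \<le> g0 x"
    and g0_pos: "AE x in Q. 0 < g0 x"
    and G_meas: "\<And>g. g \<in> G \<Longrightarrow> g \<in> borel_measurable Q"
    and G_nonneg: "\<And>g x. g \<in> G \<Longrightarrow> x \<in> space Q \<Longrightarrow> 0 \<le> g x"
begin

lemma sets_P [measurable_cong]: "sets P = sets Q"
  by (simp add: P_eq)

lemma AE_P_iff: "(AE x in P. \<phi> x) \<longleftrightarrow> (AE x in Q. \<phi> x)"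
proof -
  have "(AE x in P. \<phi> x) \<longleftrightarrow> (AE x in Q. 0 < ennreal (g0 x) \<longrightarrow> \<phi> x)"
    unfolding P_eq by (rule AE_density) simp
  also have "\<dots> \<longleftrightarrow> (AE x in Q. \<phi> x)"
    using g0_pos by (intro iffI) (auto elim: eventually_elim2)
  finally show ?thesis .
qed

lemma nn_integral_g0: "(\<integral>\<^sup>+x. ennreal (g0 x) \<partial>Q) = 1"
  using P.emeasure_space_1 by (simp add: P_eq emeasure_density cong: nn_integral_cong)

lemma integrable_g0: "integrable Q g0" and integral_g0: "(\<integral>x. g0 x \<partial>Q) = 1"
proof -
  have nn: "AE x in Q. 0 \<le> g0 x" using g0_pos by eventually_elim simp
  show i: "integrable Q g0" using nn nn_integral_g0 by (intro integrableI_nonneg) auto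
  have "ennreal (\<integral>x. g0 x \<partial>Q) = 1"
    using nn_integral_eq_integral[OF i nn] nn_integral_g0 by simp
  then show "(\<integral>x. g0 x \<partial>Q) = 1" by (metis ennreal_eq_1)
qed

lemma integrable_P_iff:
  fixes f :: "'a \<Rightarrow> real"
  assumes [measurable]: "f \<in> borel_measurable Q"
  shows "integrable P f \<longleftrightarrow> integrable Q (\<lambda>x. g0 x * f x)"
  unfolding P_eq using g0_pos by (subst integrable_density) (auto elim: eventually_mono)

lemma integral_P:
  fixes f :: "'a \<Rightarrow> real"
  assumes [measurable]: "f \<in> borel_measurable Q"
  shows "(\<integral>x. f x \<partial>P) = (\<integral>x. g0 x * f x \<partial>Q)"
  unfolding P_eq using g0_pos by (subst integral_density) (auto elim: eventually_mono)

text \<open>Stated for any \<open>g\<close>, not only members of \<open>G\<close>, because part (b)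
  applies it to midpoints.\<close>

lemma hellinger_le_log_risk:
  fixes g :: "'a \<Rightarrow> real"
  assumes g: "integrable Q g" "AE x in Q. 0 < g x" and l: "integrable P (\<lambda>x. ln (g x / g0 x))"
  shows "2 * (hellinger Q g0 g)\<^sup>2 \<le> (\<integral>x. g x - g0 x \<partial>Q) - (\<integral>x. ln (g x / g0 x) \<partial>P)"
proof -
  have [measurable]: "g \<in> borel_measurable Q" using g by simp
  have lQ: "integrable Q (\<lambda>x. g0 x * ln (g x / g0 x))" using l by (subst (asm) integrable_P_iff) auto
  have "2 * (hellinger Q g0 g)\<^sup>2 = (\<integral>x. (sqrt (g0 x) - sqrt (g x))\<^sup>2 \<partial>Q)"
    by (simp add: hellinger_power2)
  also have "\<dots> \<le> (\<integral>x. (g x - g0 x) - g0 x * ln (g x / g0 x) \<partial>Q)"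
  proof (rule integral_mono_AE')
    show "AE x in Q. (sqrt (g0 x) - sqrt (g x))\<^sup>2 \<le> (g x - g0 x) - g0 x * ln (g x / g0 x)"
      using g(2) g0_pos by eventually_elim (rule sqrt_diff_power2_le_log)
    then show "AE x in Q. 0 \<le> (g x - g0 x) - g0 x * ln (g x / g0 x)"
      by eventually_elim (rule order_trans[OF zero_le_power2])
  qed (use g integrable_g0 lQ in auto)
  also have "\<dots> = (\<integral>x. g x - g0 x \<partial>Q) - (\<integral>x. g0 x * ln (g x / g0 x) \<partial>Q)"
    using g integrable_g0 lQ by (intro Bochner_Integration.integral_diff) auto
  finally show ?thesis by (simp add: integral_P)
qed

lemma hellinger_midpoint:
  assumes g: "g \<in> G" "integrable Q g"
  shows "(hellinger Q g0 g)\<^sup>2 \<le> 16 * (hellinger Q g0 (\<lambda>x. (g x + g0 x) / 2))\<^sup>2"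
proof -
  have [measurable]: "g \<in> borel_measurable Q" using g by simp
  have "(\<integral>x. (sqrt (g0 x) - sqrt (g x))\<^sup>2 \<partial>Q) \<le> (\<integral>x. 16 * (sqrt (g0 x) - sqrt ((g x + g0 x) / 2))\<^sup>2 \<partial>Q)"
  proof (rule integral_mono_AE')
    show "integrable Q (\<lambda>x. 16 * (sqrt (g0 x) - sqrt ((g x + g0 x) / 2))\<^sup>2)"
    proof (rule Bochner_Integration.integrable_bound[where f="\<lambda>x. 16 * (g0 x + (g x + g0 x) / 2)"])
      show "AE x in Q. norm (16 * (sqrt (g0 x) - sqrt ((g x + g0 x) / 2))\<^sup>2) \<le> norm (16 * (g0 x + (g x + g0 x) / 2))"
      proof (rule AE_I2)
        fix x assume x: "x \<in> space Q"
        then have "0 \<le> g x" "0 \<le> g0 x" using G_nonneg[OF g(1)] g0_nonneg by auto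
        then have "(sqrt (g0 x) - sqrt ((g x + g0 x) / 2))\<^sup>2 \<le> g0 x + (g x + g0 x) / 2"
          by (intro sqrt_diff_power2_le_add) auto
        then have "16 * (sqrt (g0 x) - sqrt ((g x + g0 x) / 2))\<^sup>2 \<le> 16 * (g0 x + (g x + g0 x) / 2)"
          by (rule mult_left_mono) simp
        moreover have "norm a \<le> norm b" if "0 \<le> a" "a \<le> b" for a b :: real using that by simp
        ultimately show "norm (16 * (sqrt (g0 x) - sqrt ((g x + g0 x) / 2))\<^sup>2) \<le> norm (16 * (g0 x + (g x + g0 x) / 2))"
          by (meson mult_nonneg_nonneg zero_le_numeral zero_le_power2)
      qed
    qed (use g integrable_g0 in auto)
    show "AE x in Q. (sqrt (g0 x) - sqrt (g x))\<^sup>2 \<le> 16 * (sqrt (g0 x) - sqrt ((g x + g0 x) / 2))\<^sup>2"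
      using G_nonneg[OF g(1)] g0_nonneg by (intro AE_I2 sqrt_diff_midpoint) auto
  qed auto
  then show ?thesis by (simp add: hellinger_power2)
qed

text \<open>The modulus of \<open>g - g0\<close> is at most \<open>g0\<close> plus the envelope of
  \<open>G\<close>. That envelope need not be measurable, so the Borel version \<open>D\<close> of
  the supremum is compared with it through \<open>nn_integral_finite_dominated\<close>.\<close>

lemma envelope_diff_class:
  assumes "sup_measurable_class Q (diff_class G g0)" and fin: "(\<integral>\<^sup>+x. envelope0 G x \<partial>Q) < \<infinity>"
  obtains B :: "'a \<Rightarrow> real" where "integrable Q B" "\<And>x. 0 \<le> B x" "AE x in Q. \<forall>f\<in>diff_class G g0. \<bar>f x\<bar> \<le> B x"
proof (rule class_envelope[OF Q.prob_space_axioms assms(1)])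
  obtain D where [measurable]: "D \<in> borel_measurable Q"
    and D: "AE x in Q. (SUP f\<in>diff_class G g0. ennreal \<bar>f x\<bar>) = D x"
    by (rule class_sup_borel[OF Q.prob_space_axioms assms(1)])
  have "(\<integral>\<^sup>+x. D x \<partial>Q) < \<infinity>"
  proof (rule nn_integral_finite_dominated[OF _ g0_meas _ fin])
    show "AE x in Q. D x \<le> ennreal (g0 x) + envelope0 G x"
      using D AE_space
    proof eventually_elim
      case (elim x)
      have "(SUP f\<in>diff_class G g0. ennreal \<bar>f x\<bar>) \<le> ennreal (g0 x) + envelope0 G x"
      proof (rule SUP_least)
        fix f assume "f \<in> diff_class G g0"
        then obtain g where g: "g \<in> G" "f = (\<lambda>x. g x - g0 x)" by (auto simp: diff_class_def)
        have "ennreal \<bar>f x\<bar> \<le> ennreal (g0 x + \<bar>g x\<bar>)"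
          using g0_nonneg[OF elim(2)] by (intro ennreal_leI) (simp add: g)
        also have "\<dots> = ennreal (g0 x) + ennreal \<bar>g x\<bar>"
          using g0_nonneg[OF elim(2)] by (intro ennreal_plus) auto
        also have "\<dots> \<le> ennreal (g0 x) + envelope0 G x"
          unfolding envelope0_def using g by (intro add_left_mono SUP_upper)
        finally show "ennreal \<bar>f x\<bar> \<le> ennreal (g0 x) + envelope0 G x" .
      qed
      with elim show ?case by simp
    qed
  qed (simp_all add: nn_integral_g0)
  then show "(\<integral>\<^sup>+x. (SUP f\<in>diff_class G g0. ennreal \<bar>f x\<bar>) \<partial>Q) < \<infinity>"
    using nn_integral_cong_AE[OF D] by simp
qed (use that in blast)

text \<open>Where some \<open>g\<close> vanishes, its logarithm counts as 0 in the class but as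
  infinite in \<open>envelope1\<close>, so the domination holds at every point.\<close>

lemma envelope_log_ratio_class:
  assumes "sup_measurable_class P (log_ratio_class G g0)" and fin: "(\<integral>\<^sup>+x. envelope1 G g0 x \<partial>P) < \<infinity>"
  obtains B :: "'a \<Rightarrow> real" where "integrable P B" "\<And>x. 0 \<le> B x" "AE x in P. \<forall>f\<in>log_ratio_class G g0. \<bar>f x\<bar> \<le> B x"
proof (rule class_envelope[OF P.prob_space_axioms assms(1)])
  have "(SUP f\<in>log_ratio_class G g0. ennreal \<bar>f x\<bar>) \<le> envelope1 G g0 x" if x: "x \<in> space P" for x
  proof (rule SUP_least)
    fix f assume "f \<in> log_ratio_class G g0"
    then obtain g where g: "g \<in> G" "f = (\<lambda>x. ln (g x / g0 x))" by (auto simp: log_ratio_class_def)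
    have "ennreal \<bar>f x\<bar> \<le> e2ennreal \<bar>ext_ln (g x / g0 x)\<bar>"
      by (simp add: ext_ln_def g)
    also have "\<dots> \<le> envelope1 G g0 x" unfolding envelope1_def using g by (intro SUP_upper)
    finally show "ennreal \<bar>f x\<bar> \<le> envelope1 G g0 x" .
  qed
  then have "(\<integral>\<^sup>+x. (SUP f\<in>log_ratio_class G g0. ennreal \<bar>f x\<bar>) \<partial>P) \<le> (\<integral>\<^sup>+x. envelope1 G g0 x \<partial>P)"
    by (rule nn_integral_mono)
  then show "(\<integral>\<^sup>+x. (SUP f\<in>log_ratio_class G g0. ennreal \<bar>f x\<bar>) \<partial>P) < \<infinity>"
    using fin by (rule le_less_trans)
qed (use that in blast)

lemma envelope1_imp_pos:
  assumes fin: "(\<integral>\<^sup>+x. envelope1 G g0 x \<partial>P) < \<infinity>" and g: "g \<in> G"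
  shows "AE x in Q. 0 < g x"
proof -
  have [measurable]: "g \<in> borel_measurable Q" by (rule G_meas[OF g])
  \<comment> \<open>Infinite where the ratio is not positive and still below
    \<open>envelope1\<close>, so a finite integral makes that set null.\<close>
  let ?h = "\<lambda>x. if 0 < g x / g0 x then 0 else \<infinity> :: ennreal"
  have "?h x \<le> envelope1 G g0 x" for x
  proof -
    have "?h x \<le> e2ennreal \<bar>ext_ln (g x / g0 x)\<bar>" by (simp add: ext_ln_def)
    also have "\<dots> \<le> envelope1 G g0 x" unfolding envelope1_def using g by (intro SUP_upper)
    finally show ?thesis .
  qed
  then have "(\<integral>\<^sup>+x. ?h x \<partial>P) \<le> (\<integral>\<^sup>+x. envelope1 G g0 x \<partial>P)" by (intro nn_integral_mono)
  with fin have "(\<integral>\<^sup>+x. ?h x \<partial>P) \<noteq> \<infinity>" by (auto simp: top_unique)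
  then have "AE x in P. ?h x \<noteq> \<infinity>" by (intro nn_integral_PInf_AE) measurable
  then show ?thesis
    unfolding AE_P_iff using g0_pos by eventually_elim (auto simp: zero_less_divide_iff split: if_splits)
qed

text \<open>The midpoint ratio \<open>z\<close> is at least 1/2, so the modulus of its logarithm is
  at most \<open>z + 1\<close>. The weight \<open>a\<close> cancels the denominator of
  \<open>z\<close>: with \<open>a = g0 x\<close> an envelope under \<open>P\<close> follows from the
  one for \<open>G\<close> under \<open>Q\<close>.\<close>

lemma abs_ln_midpoint_le:
  fixes a b :: real
  assumes "0 < a" "0 \<le> b"
  shows "a * \<bar>ln ((b + a) / (2 * a))\<bar> \<le> 2 * a + b"
proof -
  define z where "z = (b + a) / (2 * a)"
  have z: "1 / 2 \<le> z" and za: "a * z = (b + a) / 2" using assms by (auto simp: z_def field_simps)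
  have "\<bar>ln z\<bar> \<le> z + 1"
  proof (cases "1 \<le> z")
    case True
    then show ?thesis using ln_le_minus_one[of z] by simp
  next
    case False
    have "- ln z = ln (1 / z)" using z by (simp add: ln_div)
    also have "\<dots> \<le> 1 / z - 1" using z by (intro ln_le_minus_one) auto
    also have "\<dots> \<le> 2 - 1" using z by (simp add: field_simps)
    finally show ?thesis using False z by auto
  qed
  then have "a * \<bar>ln z\<bar> \<le> a * (z + 1)" using assms(1) by (intro mult_left_mono) auto
  then have "a * \<bar>ln z\<bar> \<le> a * z + a" by (simp add: distrib_left)
  then show ?thesis unfolding za z_def[symmetric] using assms by (simp add: field_simps)
qed

lemma envelope_log_mid_class:
  assumes "sup_measurable_class P (log_mid_class G g0)" and fin: "(\<integral>\<^sup>+x. envelope0 G x \<partial>Q) < \<infinity>"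
  obtains B :: "'a \<Rightarrow> real" where "integrable P B" "\<And>x. 0 \<le> B x" "AE x in P. \<forall>f\<in>log_mid_class G g0. \<bar>f x\<bar> \<le> B x"
proof (rule class_envelope[OF P.prob_space_axioms assms(1)])
  obtain D where [measurable]: "D \<in> borel_measurable P"
    and D: "AE x in P. (SUP f\<in>log_mid_class G g0. ennreal \<bar>f x\<bar>) = D x"
    by (rule class_sup_borel[OF P.prob_space_axioms assms(1)])
  have [measurable]: "D \<in> borel_measurable Q" by measurable
  have "(\<integral>\<^sup>+x. D x \<partial>P) = (\<integral>\<^sup>+x. ennreal (g0 x) * D x \<partial>Q)"
    unfolding P_eq by (rule nn_integral_density) auto
  also have "\<dots> < \<infinity>"
  proof (rule nn_integral_finite_dominated[where k="\<lambda>x. 2 * g0 x", OF _ _ _ fin])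
    show "AE x in Q. ennreal (g0 x) * D x \<le> ennreal (2 * g0 x) + envelope0 G x"
      using D[unfolded AE_P_iff] AE_space g0_pos
    proof eventually_elim
      case (elim x)
      have "ennreal (g0 x) * (SUP f\<in>log_mid_class G g0. ennreal \<bar>f x\<bar>)
          = (SUP f\<in>log_mid_class G g0. ennreal (g0 x) * ennreal \<bar>f x\<bar>)"
        by (simp add: SUP_mult_left_ennreal)
      also have "\<dots> \<le> ennreal (2 * g0 x) + envelope0 G x"
      proof (rule SUP_least)
        fix f assume "f \<in> log_mid_class G g0"
        then obtain g where g: "g \<in> G" "f = (\<lambda>x. ln ((g x + g0 x) / (2 * g0 x)))" by (auto simp: log_mid_class_def)
        have "ennreal (g0 x) * ennreal \<bar>f x\<bar> = ennreal (g0 x * \<bar>f x\<bar>)"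
          using elim by (simp add: ennreal_mult)
        also have "\<dots> \<le> ennreal (2 * g0 x + \<bar>g x\<bar>)"
          unfolding g(2) using abs_ln_midpoint_le[of "g0 x" "g x"] G_nonneg[OF g(1) elim(2)] elim
          by (intro ennreal_leI) auto
        also have "\<dots> = ennreal (2 * g0 x) + ennreal \<bar>g x\<bar>"
          using elim by (intro ennreal_plus) auto
        also have "\<dots> \<le> ennreal (2 * g0 x) + envelope0 G x"
          unfolding envelope0_def using g by (intro add_left_mono SUP_upper)
        finally show "ennreal (g0 x) * ennreal \<bar>f x\<bar> \<le> ennreal (2 * g0 x) + envelope0 G x" .
      qed
      finally show ?case using elim by simp
    qed
    have "integrable Q (\<lambda>x. 2 * g0 x)" using integrable_g0 by simp
    then show "(\<integral>\<^sup>+x. ennreal (2 * g0 x) \<partial>Q) < \<infinity>"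
      using g0_pos by (subst nn_integral_eq_integral) (auto elim: eventually_mono)
  qed auto
  finally show "(\<integral>\<^sup>+x. (SUP f\<in>log_mid_class G g0. ennreal \<bar>f x\<bar>) \<partial>P) < \<infinity>"
    using nn_integral_cong_AE[OF D] by simp
qed (use that in blast)

lemma integrable_diff_class_imp:
  assumes B: "integrable Q B" "AE x in Q. \<forall>f\<in>diff_class G g0. \<bar>f x\<bar> \<le> B x" and g: "g \<in> G"
  shows "integrable Q g"
proof -
  have [measurable]: "g \<in> borel_measurable Q" by (rule G_meas[OF g])
  have "integrable Q (\<lambda>x. g x - g0 x)"
  proof (rule Bochner_Integration.integrable_bound[OF B(1)])
    show "AE x in Q. norm (g x - g0 x) \<le> norm (B x)"
      using B(2)
    proof eventually_elim
      case (elim x)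
      then have "\<bar>g x - g0 x\<bar> \<le> B x" using g by (auto simp: diff_class_def)
      then show ?case by simp
    qed
  qed simp
  then have "integrable Q (\<lambda>x. (g x - g0 x) + g0 x)" using integrable_g0 by (rule Bochner_Integration.integrable_add)
  then show ?thesis by simp
qed

text \<open>The deterministic core of part (a), along two fixed sample paths. The empirical gain
  \<open>s n\<close> of the estimator over \<open>g0\<close> is nonnegative by optimality and, up to
  the errors of the uniform laws, at most minus twice the squared Hellinger distance. Hence both
  tend to 0, and the objective has the same limit as at \<open>g0\<close>.\<close>

lemma argmax_consistent:
  fixes x y :: "nat \<Rightarrow> 'a" and gh :: "nat \<Rightarrow> 'a \<Rightarrow> real"
  assumes int: "\<And>g. g \<in> G \<Longrightarrow> integrable Q g" and gpos: "\<And>g. g \<in> G \<Longrightarrow> AE z in Q. 0 < g z"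
    and lint: "\<And>g. g \<in> G \<Longrightarrow> integrable P (\<lambda>z. ln (g z / g0 z))"
    and gs: "gs \<in> G" "\<And>i. gs (x i) = g0 (x i)" "\<And>i. gs (y i) = g0 (y i)" "\<And>i. 0 < g0 (x i)"
    and max: "\<And>n. 0 < n \<Longrightarrow> is_arg_max (ratio_objective (empirical n x) (empirical n y)) (\<lambda>g. g \<in> G) (gh n)"
    and UP: "\<And>\<epsilon>. 0 < \<epsilon> \<Longrightarrow> eventually (\<lambda>n. \<forall>f\<in>log_ratio_class G g0. \<bar>(\<Sum>i<n. f (x i)) / n - (\<integral>z. f z \<partial>P)\<bar> \<le> \<epsilon>) sequentially"
    and UQ: "\<And>\<epsilon>. 0 < \<epsilon> \<Longrightarrow> eventually (\<lambda>n. \<forall>f\<in>diff_class G g0. \<bar>(\<Sum>i<n. f (y i)) / n - (\<integral>z. f z \<partial>Q)\<bar> \<le> \<epsilon>) sequentially"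
  shows "(\<lambda>n. hellinger Q g0 (gh n)) \<longlonglongrightarrow> 0"
    and "(\<lambda>n. (\<Sum>i<n. ln (g0 (x i))) / n) \<longlonglongrightarrow> L \<Longrightarrow> (\<lambda>n. (\<Sum>i<n. g0 (y i)) / n) \<longlonglongrightarrow> 1
      \<Longrightarrow> (\<lambda>n. \<bar>ratio_objective (empirical n x) (empirical n y) (gh n) + 1 - ereal L\<bar>) \<longlonglongrightarrow> 0"
proof -
  let ?a = "\<lambda>n. (\<Sum>i<n. ln (g0 (x i))) / real n" and ?b = "\<lambda>n. (\<Sum>i<n. g0 (y i)) / real n"
  define s where "s n = (\<Sum>i<n. ln (gh n (x i) / g0 (x i))) / real n - (\<Sum>i<n. gh n (y i) - g0 (y i)) / real n" for n
  note opt = argmax_optimality[OF _ max gs]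
  have s_eq: "(\<Sum>i<n. ln (gh n (x i))) / n - (\<Sum>i<n. gh n (y i)) / n = ?a n - ?b n + s n" if n: "0 < n" for n
  proof -
    have "(\<Sum>i<n. ln (gh n (x i) / g0 (x i))) = (\<Sum>i<n. ln (gh n (x i)) - ln (g0 (x i)))"
    proof (rule sum.cong)
      fix i assume "i \<in> {..<n}"
      then have "0 < gh n (x i)" using opt(2)[OF n n] by auto
      then show "ln (gh n (x i) / g0 (x i)) = ln (gh n (x i)) - ln (g0 (x i))" using gs(4) by (rule ln_divide_pos)
    qed simp
    then show ?thesis by (simp add: s_def sum_subtractf diff_divide_distrib)
  qed
  have s_nonneg: "0 \<le> s n" if "0 < n" for n
    using opt(3)[OF that that] s_eq[OF that] by simp
  have main: "eventually (\<lambda>n. 0 < n \<and> s n + 2 * (hellinger Q g0 (gh n))\<^sup>2 \<le> 2 * \<epsilon>) sequentially" if "0 < \<epsilon>" for \<epsilon>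
    using UP[OF that] UQ[OF that] eventually_gt_at_top[of 0]
  proof eventually_elim
    case (elim n)
    have gh: "gh n \<in> G" by (rule opt(1)[OF elim(3) elim(3)])
    have "\<bar>(\<Sum>i<n. ln (gh n (x i) / g0 (x i))) / n - (\<integral>z. ln (gh n z / g0 z) \<partial>P)\<bar> \<le> \<epsilon>"
      using elim(1) gh by (auto simp: log_ratio_class_def)
    moreover have "\<bar>(\<Sum>i<n. gh n (y i) - g0 (y i)) / n - (\<integral>z. gh n z - g0 z \<partial>Q)\<bar> \<le> \<epsilon>"
      using elim(2) gh by (auto simp: diff_class_def)
    moreover note hellinger_le_log_risk[OF int[OF gh] gpos[OF gh] lint[OF gh]]
    ultimately show ?case using elim(3) unfolding s_def by linarith
  qed
  show "(\<lambda>n. hellinger Q g0 (gh n)) \<longlonglongrightarrow> 0"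
  proof (rule tendsto_zero_power2[where c=1])
    fix \<epsilon> :: real assume "0 < \<epsilon>"
    from main[OF this] show "eventually (\<lambda>n. (hellinger Q g0 (gh n))\<^sup>2 \<le> 1 * \<epsilon>) sequentially"
    proof eventually_elim
      case (elim n)
      with s_nonneg[of n] show ?case by simp
    qed
  qed (simp_all add: hellinger_nonneg)
  have s_lim: "s \<longlonglongrightarrow> 0"
  proof (rule tendstoI)
    fix e :: real assume "0 < e"
    then have "0 < e / 4" by simp
    from main[OF this] show "eventually (\<lambda>n. dist (s n) 0 < e) sequentially"
    proof eventually_elim
      case (elim n)
      then have "s n \<le> e / 2" using zero_le_power2[of "hellinger Q g0 (gh n)"] by linarith
      with s_nonneg[of n] elim \<open>0 < e\<close> show ?case by (simp add: dist_real_def)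
    qed
  qed
  \<comment> \<open>The limit 1 of the second sample mean is offset by the summand 1 of the
    estimated divergence.\<close>
  assume a: "?a \<longlonglongrightarrow> L" and b: "?b \<longlonglongrightarrow> 1"
  have "(\<lambda>n. \<bar>?a n - ?b n + s n + 1 - L\<bar>) \<longlonglongrightarrow> \<bar>L - 1 + 0 + 1 - L\<bar>"
    using a b s_lim by (intro tendsto_intros)
  then have "(\<lambda>n. ereal \<bar>?a n - ?b n + s n + 1 - L\<bar>) \<longlonglongrightarrow> 0"
    by (simp add: zero_ereal_def)
  moreover have "eventually (\<lambda>n. ereal \<bar>?a n - ?b n + s n + 1 - L\<bar>
      = \<bar>ratio_objective (empirical n x) (empirical n y) (gh n) + 1 - ereal L\<bar>) sequentially"
    using eventually_gt_at_top[of 0]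
  proof eventually_elim
    case (elim n)
    have "ratio_objective (empirical n x) (empirical n y) (gh n) = ereal (?a n - ?b n + s n)"
      unfolding s_eq[OF elim, symmetric]
      by (rule ratio_objective_empirical[OF elim]) (rule opt(2)[OF elim elim])
    then show ?case by (simp add: one_ereal_def)
  qed
  ultimately show "(\<lambda>n. \<bar>ratio_objective (empirical n x) (empirical n y) (gh n) + 1 - ereal L\<bar>) \<longlonglongrightarrow> 0"
    by (rule Lim_transform_eventually)
qed

text \<open>By \<open>ln_half_sum_ge\<close>, the empirical log-ratio of the midpoint is at least
  half that of the estimator, which optimality bounds below by the empirical mean of
  \<open>gh n - g0\<close>. The uniform laws carry this to the population, where
  \<open>hellinger_le_log_risk\<close> controls the midpoint and \<open>hellinger_midpoint\<close>
  returns to the estimator.\<close>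

lemma argmax_consistent_midpoint:
  fixes x y :: "nat \<Rightarrow> 'a" and gh :: "nat \<Rightarrow> 'a \<Rightarrow> real"
  assumes int: "\<And>g. g \<in> G \<Longrightarrow> integrable Q g"
    and lint: "\<And>g. g \<in> G \<Longrightarrow> integrable P (\<lambda>z. ln ((g z + g0 z) / (2 * g0 z)))"
    and gs: "gs \<in> G" "\<And>i. gs (x i) = g0 (x i)" "\<And>i. gs (y i) = g0 (y i)" "\<And>i. 0 < g0 (x i)"
    and max: "\<And>n. 0 < n \<Longrightarrow> is_arg_max (ratio_objective (empirical n x) (empirical n y)) (\<lambda>g. g \<in> G) (gh n)"
    and UP: "\<And>\<epsilon>. 0 < \<epsilon> \<Longrightarrow> eventually (\<lambda>n. \<forall>f\<in>log_mid_class G g0. \<bar>(\<Sum>i<n. f (x i)) / n - (\<integral>z. f z \<partial>P)\<bar> \<le> \<epsilon>) sequentially"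
    and UQ: "\<And>\<epsilon>. 0 < \<epsilon> \<Longrightarrow> eventually (\<lambda>n. \<forall>f\<in>diff_class G g0. \<bar>(\<Sum>i<n. f (y i)) / n - (\<integral>z. f z \<partial>Q)\<bar> \<le> \<epsilon>) sequentially"
  shows "(\<lambda>n. hellinger Q g0 (gh n)) \<longlonglongrightarrow> 0"
proof (rule tendsto_zero_power2[where c=16])
  note opt = argmax_optimality[OF _ max gs]
  fix \<epsilon> :: real assume "0 < \<epsilon>"
  from UP[OF this] UQ[OF this] eventually_gt_at_top[of 0]
  show "eventually (\<lambda>n. (hellinger Q g0 (gh n))\<^sup>2 \<le> 16 * \<epsilon>) sequentially"
  proof eventually_elim
    case (elim n)
    have gh: "gh n \<in> G" by (rule opt(1)[OF elim(3) elim(3)])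
    let ?m = "\<lambda>z. (gh n z + g0 z) / 2"
    have emp: "0 \<le> (\<Sum>i<n. ln ((gh n (x i) + g0 (x i)) / (2 * g0 (x i)))) / n - (\<Sum>i<n. gh n (y i) - g0 (y i)) / n / 2"
    proof -
      have "(\<Sum>i<n. ln (gh n (x i)) - ln (g0 (x i))) / 2 \<le> (\<Sum>i<n. ln ((gh n (x i) + g0 (x i)) / (2 * g0 (x i))))"
        unfolding sum_divide_distrib
      proof (rule sum_mono)
        fix i assume "i \<in> {..<n}"
        then have "0 < gh n (x i)" using opt(2)[OF elim(3) elim(3)] by auto
        then show "(ln (gh n (x i)) - ln (g0 (x i))) / 2 \<le> ln ((gh n (x i) + g0 (x i)) / (2 * g0 (x i)))"
          using ln_half_sum_ge[OF gs(4)[of i], of "gh n (x i)"] gs(4)[of i] by (simp add: ln_div)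
      qed
      then have "(\<Sum>i<n. ln (gh n (x i)) - ln (g0 (x i))) / 2 / n \<le> (\<Sum>i<n. ln ((gh n (x i) + g0 (x i)) / (2 * g0 (x i)))) / n"
        by (rule divide_right_mono) simp
      with opt(3)[OF elim(3) elim(3)] show ?thesis
        by (simp add: sum_subtractf diff_divide_distrib)
    qed
    \<comment> \<open>The assumptions give \<open>2 * h \<le> 3 * \<epsilon> / 2\<close>, hence
      \<open>h' \<le> 12 * \<epsilon>\<close>; the constant 16 is a rounder bound.\<close>
    have arith: "h' \<le> 16 * \<epsilon>" if "\<bar>p - p'\<bar> \<le> \<epsilon>" "\<bar>q - q'\<bar> \<le> \<epsilon>" "2 * h \<le> q' / 2 - p'" "h' \<le> 16 * h" "0 \<le> p - q / 2"
      for p p' q q' h h' :: real using that \<open>0 < \<epsilon>\<close> by linarith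
    have devP: "\<bar>(\<Sum>i<n. ln ((gh n (x i) + g0 (x i)) / (2 * g0 (x i)))) / n - (\<integral>z. ln ((gh n z + g0 z) / (2 * g0 z)) \<partial>P)\<bar> \<le> \<epsilon>"
      using elim(1) gh by (auto simp: log_mid_class_def)
    have devQ: "\<bar>(\<Sum>i<n. gh n (y i) - g0 (y i)) / n - (\<integral>z. gh n z - g0 z \<partial>Q)\<bar> \<le> \<epsilon>"
      using elim(2) gh by (auto simp: diff_class_def)
    have risk: "2 * (hellinger Q g0 ?m)\<^sup>2 \<le> (\<integral>z. ?m z - g0 z \<partial>Q) - (\<integral>z. ln (?m z / g0 z) \<partial>P)"
    proof (rule hellinger_le_log_risk)
      show "integrable Q ?m" using int[OF gh] integrable_g0 by auto
      show "AE z in Q. 0 < ?m z"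
        using g0_pos AE_space by eventually_elim (use G_nonneg[OF gh] in \<open>auto intro: add_nonneg_pos\<close>)
      show "integrable P (\<lambda>z. ln (?m z / g0 z))" using lint[OF gh] by simp
    qed
    have half: "(\<integral>z. ?m z - g0 z \<partial>Q) = (\<integral>z. gh n z - g0 z \<partial>Q) / 2"
    proof -
      have "(\<integral>z. ?m z - g0 z \<partial>Q) = (\<integral>z. (gh n z - g0 z) / 2 \<partial>Q)"
        by (rule Bochner_Integration.integral_cong) (auto simp: field_simps)
      then show ?thesis by simp
    qed
    have "2 * (hellinger Q g0 ?m)\<^sup>2 \<le> (\<integral>z. gh n z - g0 z \<partial>Q) / 2 - (\<integral>z. ln ((gh n z + g0 z) / (2 * g0 z)) \<partial>P)"
      using risk unfolding half by simp
    from arith[OF devP devQ this hellinger_midpoint[OF gh int[OF gh]] emp] show ?case .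
  qed
qed (simp_all add: hellinger_nonneg)

end

section \<open>From the joint sample and the densities to the locales\<close>

lemma (in prob_space) indep_vars_reindex:
  assumes ind: "indep_vars N Z I" and h: "inj_on h J" "h ` J \<subseteq> I"
  shows "indep_vars (\<lambda>j. N (h j)) (\<lambda>j. Z (h j)) J"
  unfolding indep_vars_def2
proof
  let ?E = "\<lambda>i. {Z i -` A \<inter> space M | A. A \<in> sets (N i)}"
  have sets: "indep_sets ?E I"
    and rv: "\<And>i. i \<in> I \<Longrightarrow> random_variable (N i) (Z i)"
    using ind by (auto simp: indep_vars_def2)
  show "\<forall>j\<in>J. random_variable (N (h j)) (Z (h j))" using rv h by auto
  have "indep_sets (\<lambda>j. ?E (h j)) J"
    unfolding indep_sets_def
  proof (intro conjI ballI allI impI)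
    show "?E (h j) \<subseteq> events" if "j \<in> J" for j
      using sets h that by (auto simp: indep_sets_def)
  next
    fix K A assume K: "K \<subseteq> J" "K \<noteq> {}" "finite K" and A: "A \<in> (\<Pi> j\<in>K. ?E (h j))"
    have inj: "inj_on h K" using h K by (auto intro: inj_on_subset)
    \<comment> \<open>Events indexed by \<open>K\<close> are moved to the image of \<open>K\<close>
      under \<open>h\<close>; injectivity prevents two of them from landing on the same
      variable.\<close>
    define A' where "A' i = A (the_inv_into K h i)" for i
    have A': "A' (h j) = A j" if "j \<in> K" for j
      using that inj by (simp add: A'_def the_inv_into_f_f)
    have "prob (\<Inter>i\<in>h ` K. A' i) = (\<Prod>i\<in>h ` K. prob (A' i))"
    proof (rule indep_setsD[OF sets])
      show "h ` K \<subseteq> I" using h(2) K(1) by blast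
    qed (use A' A K in \<open>auto simp: Pi_iff\<close>)
    then show "prob (\<Inter>j\<in>K. A j) = (\<Prod>j\<in>K. prob (A j))"
      using A' by (simp add: prod.reindex[OF inj])
  qed
  then show "indep_sets (\<lambda>j. {Z (h j) -` A \<inter> space M | A. A \<in> sets (N (h j))}) J" .
qed

text \<open>The observations are given with values in \<mu>, while \<open>iid_sample\<close> uses
  the law \<open>R\<close> also as the measurable space; both have the same measurable sets.\<close>

lemma iid_sampleI:
  assumes \<Omega>: "prob_space \<Omega>" and ind: "prob_space.indep_vars \<Omega> (\<lambda>_. \<mu>) X UNIV"
    and law: "\<And>i. distr \<Omega> \<mu> (X i) = R"
  shows "iid_sample \<Omega> R X"
proof -
  interpret prob_space \<Omega> by fact
  have sets: "sets R = sets \<mu>" by (subst law[of 0, symmetric]) simp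
  show ?thesis
  proof
    show "indep_vars (\<lambda>_. R) X UNIV"
      using ind unfolding indep_vars_def2 sets by (simp add: measurable_cong_sets[OF refl sets])
    show "distr \<Omega> R (X i) = R" for i
      using law[of i] by (simp add: distr_cong[OF refl sets refl])
  qed
qed

text \<open>The negative part of \<open>p ln (p / q)\<close> is dominated by \<open>q\<close>, so it is always integrable.\<close>

lemma KL_div_finite:
  fixes p q :: "'a \<Rightarrow> real"
  assumes p[measurable]: "p \<in> borel_measurable \<mu>" and q[measurable]: "q \<in> borel_measurable \<mu>"
    and nonneg: "\<And>x. x \<in> space \<mu> \<Longrightarrow> 0 \<le> p x" "\<And>x. x \<in> space \<mu> \<Longrightarrow> 0 \<le> q x"
    and q1: "(\<integral>\<^sup>+x. ennreal (q x) \<partial>\<mu>) < \<infinity>" and fin: "KL_div \<mu> p q < \<infinity>"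
  shows "integrable \<mu> (\<lambda>x. p x * ln (p x / q x))"
    and "KL_div \<mu> p q = ereal (\<integral>x. p x * ln (p x / q x) \<partial>\<mu>)"
proof -
  let ?f = "\<lambda>x. p x * ln (p x / q x)"
  let ?A = "\<integral>\<^sup>+x. ennreal (?f x) \<partial>\<mu>" and ?B = "\<integral>\<^sup>+x. ennreal (- ?f x) \<partial>\<mu>"
  have KL: "KL_div \<mu> p q = enn2ereal ?A - enn2ereal ?B"
    by (simp add: KL_div_def ext_integral_def)
  have "?B \<le> (\<integral>\<^sup>+x. ennreal (q x) \<partial>\<mu>)"
  proof (rule nn_integral_mono, rule ennreal_leI)
    fix x assume x: "x \<in> space \<mu>"
    show "- ?f x \<le> q x"
    proof (cases "0 < p x \<and> 0 < q x")
      case True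
      then have "- ?f x = p x * ln (q x / p x)" by (simp add: ln_div algebra_simps)
      also have "\<dots> \<le> p x * (q x / p x - 1)" using True by (intro mult_left_mono ln_le_minus_one) auto
      also have "\<dots> = q x - p x" using True by (simp add: field_simps)
      finally show ?thesis using True by simp
    next
      case False
      \<comment> \<open>Division by 0 and \<open>ln 0\<close> both give 0, so the integrand vanishes
        here.\<close>
      then have "p x = 0 \<or> q x = 0" using nonneg[OF x] by auto
      then show ?thesis using nonneg[OF x] by auto
    qed
  qed
  then have B: "?B < \<infinity>" using q1 by (rule le_less_trans)
  have A: "?A < \<infinity>"
  proof (rule ccontr)
    assume "\<not> ?A < \<infinity>"
    then have "?A = \<infinity>" by (simp add: less_top[symmetric])
    moreover obtain b where "?B = ennreal b" "0 \<le> b" using B by (cases ?B) auto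
    ultimately show False using fin unfolding KL by (simp add: enn2ereal_ennreal)
  qed
  show i: "integrable \<mu> ?f"
    using A B unfolding real_integrable_def by (auto simp: less_top)
  obtain a b where "?A = ennreal a" "0 \<le> a" "?B = ennreal b" "0 \<le> b"
    using A B by (cases ?A; cases ?B) auto
  then show "KL_div \<mu> p q = ereal (\<integral>x. ?f x \<partial>\<mu>)"
    unfolding KL real_lebesgue_integral_def[OF i] by (simp add: enn2ereal_ennreal)
qed

theorem theorem1:
  fixes \<X> :: "'a::euclidean_space set"
    and \<mu> P Q :: "'a measure"
    and p0 q0 g0 :: "'a \<Rightarrow> real"
    and \<G> :: "('a \<Rightarrow> real) set"
    and M :: "'w measure"
    and X Y :: "nat \<Rightarrow> 'w \<Rightarrow> 'a"
    and ghat :: "nat \<Rightarrow> 'w \<Rightarrow> 'a \<Rightarrow> real"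
    and Pn Qn :: "nat \<Rightarrow> 'w \<Rightarrow> 'a measure"
    and Dhat :: "nat \<Rightarrow> 'w \<Rightarrow> ereal"
  assumes domain: "compact \<X>"
    and mu: "\<mu> = restrict_space lborel \<X>"
    and p0: "p0 \<in> borel_measurable \<mu>" "\<forall>x\<in>\<X>. 0 \<le> p0 x"
    and q0: "q0 \<in> borel_measurable \<mu>" "\<forall>x\<in>\<X>. 0 \<le> q0 x"
    and P: "P = density \<mu> (\<lambda>x. ennreal (p0 x))" "prob_space P"
    and Q: "Q = density \<mu> (\<lambda>x. ennreal (q0 x))" "prob_space Q"
    and abs_cont: "absolutely_continuous Q P"
    and same_support: "AE x in \<mu>. 0 < p0 x \<longleftrightarrow> 0 < q0 x"
    and g0: "g0 = (\<lambda>x. p0 x / q0 x)"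
    and M: "prob_space M"
    and indep: "prob_space.indep_vars M (\<lambda>_. \<mu>) (case_sum X Y) (UNIV :: (nat + nat) set)"
    and X_distr: "\<forall>i. distr M \<mu> (X i) = P"
    and Y_distr: "\<forall>i. distr M \<mu> (Y i) = Q"
    and Pn: "Pn = (\<lambda>n \<omega>. empirical n (\<lambda>i. X i \<omega>))"
    and Qn: "Qn = (\<lambda>n \<omega>. empirical n (\<lambda>i. Y i \<omega>))"
    and G: "\<forall>g\<in>\<G>. g \<in> borel_measurable \<mu> \<and> (\<forall>x\<in>\<X>. 0 \<le> g x)"
    and ghat: "\<forall>n>0. AE \<omega> in M.
      is_arg_max (ratio_objective (Pn n \<omega>) (Qn n \<omega>)) (\<lambda>g. g \<in> \<G>) (ghat n \<omega>)"
    and Dhat: "Dhat = (\<lambda>n \<omega>. ratio_objective (Pn n \<omega>) (Qn n \<omega>) (ghat n \<omega>) + 1)"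
    and KL_finite: "KL_div \<mu> p0 q0 < \<infinity>"
    and well_specified: "\<exists>g\<in>\<G>. AE x in Q. g x = g0 x"
  shows
    "((\<integral>\<^sup>+x. envelope0 \<G> x \<partial>Q) < \<infinity> \<longrightarrow>
      (\<integral>\<^sup>+x. envelope1 \<G> g0 x \<partial>P) < \<infinity> \<longrightarrow>
      sup_measurable_class Q (diff_class \<G> g0) \<longrightarrow>
      sup_measurable_class P (log_ratio_class \<G> g0) \<longrightarrow>
      (\<forall>\<delta>>0. tendsto_zero_in_prob M
         (\<lambda>n \<omega>. metric_entropy \<delta> (diff_class \<G> g0) (Qn n \<omega>) / ereal (real n))) \<longrightarrow>
      (\<forall>\<delta>>0. tendsto_zero_in_prob M
         (\<lambda>n \<omega>. metric_entropy \<delta> (log_ratio_class \<G> g0) (Pn n \<omega>) / ereal (real n))) \<longrightarrow>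
      (AE \<omega> in M. (\<lambda>n. \<bar>Dhat n \<omega> - KL_div \<mu> p0 q0\<bar>) \<longlonglongrightarrow> 0) \<and>
      (AE \<omega> in M. (\<lambda>n. hellinger Q g0 (ghat n \<omega>)) \<longlonglongrightarrow> 0))
     \<and>
     ((\<integral>\<^sup>+x. envelope0 \<G> x \<partial>Q) < \<infinity> \<longrightarrow>
      sup_measurable_class Q (diff_class \<G> g0) \<longrightarrow>
      sup_measurable_class P (log_mid_class \<G> g0) \<longrightarrow>
      (\<forall>\<delta>>0. tendsto_zero_in_prob M
         (\<lambda>n \<omega>. metric_entropy \<delta> (diff_class \<G> g0) (Qn n \<omega>) / ereal (real n))) \<longrightarrow>
      (\<forall>\<delta>>0. tendsto_zero_in_prob M
         (\<lambda>n \<omega>. metric_entropy \<delta> (log_mid_class \<G> g0) (Pn n \<omega>) / ereal (real n))) \<longrightarrow>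
      (AE \<omega> in M. (\<lambda>n. hellinger Q g0 (ghat n \<omega>)) \<longlonglongrightarrow> 0))"
proof -
  interpret \<Omega>: prob_space M by fact
  interpret PP: prob_space P by fact
  interpret QQ: prob_space Q by fact
  have sp: "space \<mu> = \<X>" unfolding mu by (simp add: space_restrict_space)
  have [measurable]: "p0 \<in> borel_measurable \<mu>" "q0 \<in> borel_measurable \<mu>" by fact+
  have g0_meas[measurable]: "g0 \<in> borel_measurable \<mu>" unfolding g0 by measurable
  have sets_Q: "sets Q = sets \<mu>" and space_Q: "space Q = \<X>" unfolding Q using sp by simp_all
  have meas_Q: "borel_measurable Q = borel_measurable \<mu>"
    by (rule measurable_cong_sets) (simp_all add: sets_Q)
  have P_Q: "P = density Q (\<lambda>x. ennreal (g0 x))"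
  proof -
    have "density Q (\<lambda>x. ennreal (g0 x)) = density \<mu> (\<lambda>x. ennreal (q0 x) * ennreal (g0 x))"
      unfolding Q(1) by (rule density_density_eq) auto
    also have "\<dots> = P"
      unfolding P(1)
    proof (rule density_cong)
      \<comment> \<open>The delicate case is \<open>q0 x = 0\<close>, where the common support gives
        \<open>p0 x = 0\<close>.\<close>
      show "AE x in \<mu>. ennreal (q0 x) * ennreal (g0 x) = ennreal (p0 x)"
        using same_support AE_space
      proof eventually_elim
        case (elim x)
        then have "0 \<le> p0 x" "0 \<le> q0 x" using p0(2) q0(2) sp by auto
        then show ?case using elim by (auto simp: g0 ennreal_mult[symmetric])
      qed
    qed auto
    finally show ?thesis by simp
  qed
  have g0_pos: "AE x in Q. 0 < g0 x"
    unfolding Q(1) by (subst AE_density) (use same_support in \<open>auto simp: g0 elim!: eventually_mono\<close>)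
  interpret likelihood_ratio P Q g0 \<G>
    by unfold_locales (use P_Q g0_pos g0_meas G p0 q0 in \<open>auto simp: meas_Q space_Q g0\<close>)
  have "iid_sample M P X"
  proof (rule iid_sampleI[OF M, of \<mu>])
    show "\<Omega>.indep_vars (\<lambda>_. \<mu>) X UNIV"
      using \<Omega>.indep_vars_reindex[OF indep, of Inl UNIV] by (simp add: inj_def)
  qed (use X_distr in auto)
  then interpret XX: iid_sample M P X .
  have "iid_sample M Q Y"
  proof (rule iid_sampleI[OF M, of \<mu>])
    show "\<Omega>.indep_vars (\<lambda>_. \<mu>) Y UNIV"
      using \<Omega>.indep_vars_reindex[OF indep, of Inr UNIV] by (simp add: inj_def)
  qed (use Y_distr in auto)
  then interpret YY: iid_sample M Q Y .
  obtain gs where gs: "gs \<in> \<G>" "AE x in Q. gs x = g0 x" using well_specified by blast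
  have ne: "diff_class \<G> g0 \<noteq> {}" "log_ratio_class \<G> g0 \<noteq> {}" "log_mid_class \<G> g0 \<noteq> {}"
    using gs(1) by (auto simp: diff_class_def log_ratio_class_def log_mid_class_def)
  have G_meas_Q: "g \<in> borel_measurable Q" if "g \<in> \<G>" for g using G that by (simp add: meas_Q)
  have meas_P: "borel_measurable P = borel_measurable Q"
    by (rule measurable_cong_sets) (simp_all add: sets_P)
  have diff_meas: "f \<in> borel_measurable Q" if "f \<in> diff_class \<G> g0" for f
    using that G_meas_Q by (auto simp: diff_class_def)
  have ratio_meas: "f \<in> borel_measurable P" if "f \<in> log_ratio_class \<G> g0" for f
    using that G_meas_Q by (auto simp: log_ratio_class_def meas_P)
  have mid_meas: "f \<in> borel_measurable P" if "f \<in> log_mid_class \<G> g0" for f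
    using that G_meas_Q by (auto simp: log_mid_class_def meas_P)
  \<comment> \<open>\<open>gs = g0\<close> is known almost everywhere under \<open>Q\<close>; it
    reaches observations from \<open>P\<close> because the null sets agree.\<close>
  have X_good: "AE \<omega> in M. \<forall>i. gs (X i \<omega>) = g0 (X i \<omega>) \<and> 0 < g0 (X i \<omega>)"
    by (rule XX.AE_sample) (use gs(2) g0_pos in \<open>auto simp: AE_P_iff\<close>)
  have Y_good: "AE \<omega> in M. \<forall>i. gs (Y i \<omega>) = g0 (Y i \<omega>)"
    by (rule YY.AE_sample) (rule gs(2))
  \<comment> \<open>One null set for each \<open>n\<close>; at \<open>n = 0\<close> nothing is
    claimed.\<close>
  have argmax: "AE \<omega> in M. \<forall>n>0. is_arg_max (ratio_objective (empirical n (\<lambda>i. X i \<omega>)) (empirical n (\<lambda>i. Y i \<omega>)))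
      (\<lambda>g. g \<in> \<G>) (ghat n \<omega>)"
    unfolding AE_all_countable using ghat[unfolded Pn Qn] by (auto intro: AE_I2)
  have UQ: "AE \<omega> in M. \<forall>\<epsilon>>0. eventually (\<lambda>n. \<forall>f\<in>diff_class \<G> g0.
        \<bar>(\<Sum>i<n. f (Y i \<omega>)) / n - (\<integral>y. f y \<partial>Q)\<bar> \<le> \<epsilon>) sequentially"
    and int: "\<And>g. g \<in> \<G> \<Longrightarrow> integrable Q g"
    if fin: "(\<integral>\<^sup>+x. envelope0 \<G> x \<partial>Q) < \<infinity>" and sm: "sup_measurable_class Q (diff_class \<G> g0)"
      and ent: "\<forall>\<delta>>0. tendsto_zero_in_prob M
         (\<lambda>n \<omega>. metric_entropy \<delta> (diff_class \<G> g0) (Qn n \<omega>) / ereal (real n))"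
  proof -
    obtain B where B: "integrable Q B" "\<And>x. 0 \<le> B x" "AE x in Q. \<forall>f\<in>diff_class \<G> g0. \<bar>f x\<bar> \<le> B x"
      by (rule envelope_diff_class[OF sm fin]) blast
    show "AE \<omega> in M. \<forall>\<epsilon>>0. eventually (\<lambda>n. \<forall>f\<in>diff_class \<G> g0.
        \<bar>(\<Sum>i<n. f (Y i \<omega>)) / n - (\<integral>y. f y \<partial>Q)\<bar> \<le> \<epsilon>) sequentially"
      by (rule YY.uniform_law_of_large_numbers[OF sm ne(1) diff_meas B]) (use ent in \<open>simp_all add: Qn\<close>)
    show "\<And>g. g \<in> \<G> \<Longrightarrow> integrable Q g" by (rule integrable_diff_class_imp[OF B(1,3)])
  qed
  show ?thesis
  proof (intro conjI impI)
    assume fin0: "(\<integral>\<^sup>+x. envelope0 \<G> x \<partial>Q) < \<infinity>" and fin1: "(\<integral>\<^sup>+x. envelope1 \<G> g0 x \<partial>P) < \<infinity>"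
      and smQ: "sup_measurable_class Q (diff_class \<G> g0)" and smP: "sup_measurable_class P (log_ratio_class \<G> g0)"
      and entQ: "\<forall>\<delta>>0. tendsto_zero_in_prob M
         (\<lambda>n \<omega>. metric_entropy \<delta> (diff_class \<G> g0) (Qn n \<omega>) / ereal (real n))"
      and entP: "\<forall>\<delta>>0. tendsto_zero_in_prob M
         (\<lambda>n \<omega>. metric_entropy \<delta> (log_ratio_class \<G> g0) (Pn n \<omega>) / ereal (real n))"
    obtain B where B: "integrable P B" "\<And>x. 0 \<le> B x" "AE x in P. \<forall>f\<in>log_ratio_class \<G> g0. \<bar>f x\<bar> \<le> B x"
      by (rule envelope_log_ratio_class[OF smP fin1]) blast
    have UP: "AE \<omega> in M. \<forall>\<epsilon>>0. eventually (\<lambda>n. \<forall>f\<in>log_ratio_class \<G> g0.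
        \<bar>(\<Sum>i<n. f (X i \<omega>)) / n - (\<integral>y. f y \<partial>P)\<bar> \<le> \<epsilon>) sequentially"
      by (rule XX.uniform_law_of_large_numbers[OF smP ne(2) ratio_meas B]) (use entP in \<open>simp_all add: Pn\<close>)
    have gpos: "\<And>g. g \<in> \<G> \<Longrightarrow> AE z in Q. 0 < g z" by (rule envelope1_imp_pos[OF fin1])
    have lint: "integrable P (\<lambda>z. ln (g z / g0 z))" if "g \<in> \<G>" for g
    proof -
      have "(\<lambda>z. ln (g z / g0 z)) \<in> log_ratio_class \<G> g0" using that by (auto simp: log_ratio_class_def)
      from class_integrable[OF B(1,3) this ratio_meas[OF this]] show ?thesis .
    qed
    note int = int[OF fin0 smQ entQ]
    have q1: "(\<integral>\<^sup>+x. ennreal (q0 x) \<partial>\<mu>) < \<infinity>"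
    proof -
      have "(\<integral>\<^sup>+x. ennreal (q0 x) \<partial>\<mu>) = emeasure Q (space Q)"
        unfolding Q(1) by (simp add: emeasure_density cong: nn_integral_cong)
      then show ?thesis by (simp add: QQ.emeasure_space_1)
    qed
    define L where "L = (\<integral>x. ln (g0 x) \<partial>P)"
    have KL: "integrable P (\<lambda>x. ln (g0 x))" "KL_div \<mu> p0 q0 = ereal L"
    proof -
      have nonneg: "\<And>x. x \<in> space \<mu> \<Longrightarrow> 0 \<le> p0 x" "\<And>x. x \<in> space \<mu> \<Longrightarrow> 0 \<le> q0 x"
        using p0(2) q0(2) sp by auto
      note KL = KL_div_finite[OF p0(1) q0(1) nonneg q1 KL_finite]
      have ae: "AE x in \<mu>. 0 \<le> p0 x" using nonneg by (intro AE_I2)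
      show "integrable P (\<lambda>x. ln (g0 x))"
        unfolding P(1) using KL(1) ae by (subst integrable_density) (auto simp: g0)
      have "L = (\<integral>x. p0 x * ln (p0 x / q0 x) \<partial>\<mu>)"
        unfolding L_def P(1) using ae by (subst integral_density) (auto simp: g0)
      with KL(2) show "KL_div \<mu> p0 q0 = ereal L" by simp
    qed
    show "AE \<omega> in M. (\<lambda>n. hellinger Q g0 (ghat n \<omega>)) \<longlonglongrightarrow> 0"
      using X_good Y_good argmax UP UQ[OF fin0 smQ entQ]
    proof eventually_elim
      case (elim \<omega>)
      show ?case
        by (rule argmax_consistent(1)[where x="\<lambda>i. X i \<omega>" and y="\<lambda>i. Y i \<omega>", OF int gpos lint gs(1)])
           (use elim in auto)
    qed
    show "AE \<omega> in M. (\<lambda>n. \<bar>Dhat n \<omega> - KL_div \<mu> p0 q0\<bar>) \<longlonglongrightarrow> 0"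
      using X_good Y_good argmax UP UQ[OF fin0 smQ entQ] XX.iid_strong_law[OF KL(1)] YY.iid_strong_law[OF integrable_g0]
    proof eventually_elim
      case (elim \<omega>)
      show ?case
        unfolding Dhat Pn Qn KL(2)
        by (rule argmax_consistent(2)[where x="\<lambda>i. X i \<omega>" and y="\<lambda>i. Y i \<omega>", OF int gpos lint gs(1)])
           (use elim in \<open>auto simp: L_def integral_g0\<close>)
    qed
  next
    assume fin0: "(\<integral>\<^sup>+x. envelope0 \<G> x \<partial>Q) < \<infinity>"
      and smQ: "sup_measurable_class Q (diff_class \<G> g0)" and smP: "sup_measurable_class P (log_mid_class \<G> g0)"
      and entQ: "\<forall>\<delta>>0. tendsto_zero_in_prob M
         (\<lambda>n \<omega>. metric_entropy \<delta> (diff_class \<G> g0) (Qn n \<omega>) / ereal (real n))"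
      and entP: "\<forall>\<delta>>0. tendsto_zero_in_prob M
         (\<lambda>n \<omega>. metric_entropy \<delta> (log_mid_class \<G> g0) (Pn n \<omega>) / ereal (real n))"
    obtain B where B: "integrable P B" "\<And>x. 0 \<le> B x" "AE x in P. \<forall>f\<in>log_mid_class \<G> g0. \<bar>f x\<bar> \<le> B x"
      by (rule envelope_log_mid_class[OF smP fin0]) blast
    have UP: "AE \<omega> in M. \<forall>\<epsilon>>0. eventually (\<lambda>n. \<forall>f\<in>log_mid_class \<G> g0.
        \<bar>(\<Sum>i<n. f (X i \<omega>)) / n - (\<integral>y. f y \<partial>P)\<bar> \<le> \<epsilon>) sequentially"
      by (rule XX.uniform_law_of_large_numbers[OF smP ne(3) mid_meas B]) (use entP in \<open>simp_all add: Pn\<close>)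
    have lint: "integrable P (\<lambda>z. ln ((g z + g0 z) / (2 * g0 z)))" if "g \<in> \<G>" for g
    proof -
      have "(\<lambda>z. ln ((g z + g0 z) / (2 * g0 z))) \<in> log_mid_class \<G> g0" using that by (auto simp: log_mid_class_def)
      from class_integrable[OF B(1,3) this mid_meas[OF this]] show ?thesis .
    qed
    note int = int[OF fin0 smQ entQ]
    show "AE \<omega> in M. (\<lambda>n. hellinger Q g0 (ghat n \<omega>)) \<longlonglongrightarrow> 0"
      using X_good Y_good argmax UP UQ[OF fin0 smQ entQ]
    proof eventually_elim
      case (elim \<omega>)
      show ?case
        by (rule argmax_consistent_midpoint[where x="\<lambda>i. X i \<omega>" and y="\<lambda>i. Y i \<omega>", OF int lint gs(1)])
           (use elim in auto)
    qed
  qed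
qed

end
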